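(* Let $\mathcal A_0$ be the quotient of the algebra $\mathcal A$ by the two-sided ideal generated by the Casimir element $C$ and by all $\mathcal O_A^{(g)}-\mathcal O_A^{(1)}$, $\mathcal O_B^{(g)}-\mathcal O_B^{(1)}$, $g\in Free_2$. Then the algebra $\mathcal A_0$ is isomorphic to a finite-dimensional representation of the $A_1$ spherical double affine Hecke algebra at the level $K=2$. Moreover, this isomorphism is equivariant with respect to the $PSL(2,\mathbb Z)$-action by automorphisms.
   Context: **Algebra $\mathcal A$.** Let $Free_2=\langle a,b\rangle$ be the free group on two generators and $\sigma$ its automorphism exchanging $a$ and $b$. Let $\mathbf k=\mathbb C(Q)$ and let $\mathcal F=\mathbf k\langle \mathcal O_A^{(g)},\mathcal O_B^{(g)}\mid g\in Free_2\rangle$ be the free associative $\mathbf k$-algebra. Let $\mathcal I\subset\mathcal F$ be the two-sided ideal generated by the following elements, for all $g,g_1,g_2,g_3\in Free_2$ and $X\in\{A,B\}$: - $\mathcal O_A^{(ag)}-\mathcal O_A^{(g)}$, $\ \mathcal O_B^{(bg)}-\mathcal O_B^{(g)}$; - $\mathcal O_X^{(g)}\mathcal O_X^{(g)}-\mathcal O_X^{(1)}\mathcal O_X^{(1)}$; - $\mathcal O_B^{(g_1)}\mathcal O_A^{(g_2)}\mathcal O_B^{(g_3)}$, $\ \mathcal O_A^{(g_1)}\mathcal O_B^{(g_2)}\mathcal O_A^{(g_3)}$; - $\mathcal O_X^{(1)}\mathcal O_X^{(1)}\mathcal O_X^{(g)}+(Q^2-Q^{-2})^2\mathcal O_X^{(g)}$,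 $\ \mathcal O_X^{(g)}\mathcal O_X^{(1)}\mathcal O_X^{(1)}+(Q^2-Q^{-2})^2\mathcal O_X^{(g)}$; - $\mathcal O_A^{(1)}\mathcal O_A^{(1)}\mathcal O_B^{(g)}+(Q^2-Q^{-2})^2\mathcal O_B^{(g)}+\mathcal O_B^{(g)}\mathcal O_A^{(1)}\mathcal O_A^{(1)}$; - $\mathcal O_B^{(1)}\mathcal O_B^{(1)}\mathcal O_A^{(g)}+(Q^2-Q^{-2})^2\mathcal O_A^{(g)}+\mathcal O_A^{(g)}\mathcal O_B^{(1)}\mathcal O_B^{(1)}$; - $\mathcal O_A^{(g_2)}\mathcal O_A^{(g_1abag_2)}\mathcal O_B^{(ag_2)}+\mathcal O_B^{(ag_2)}\mathcal O_A^{(g_1abag_2)}\mathcal O_A^{(g_2)}-\mathcal O_B^{(g_2)}\mathcal O_B^{(\sigma(g_1)g_2)}\mathcal O_B^{(g_2)}$; - $\mathcal O_B^{(g_2)}\mathcal O_B^{(g_1babg_2)}\mathcal O_A^{(bg_2)}+\mathcal O_A^{(bg_2)}\mathcal O_B^{(g_1babg_2)}\mathcal O_B^{(g_2)}-\mathcal O_A^{(g_2)}\mathcal O_A^{(\sigma(g_1)g_2)}\mathcal O_A^{(g_2)}$; - $\mathcal O_A^{(g_2)}\mathcal O_A^{(g_1a^{-1}b^{-1}a^{-1}g_2)}\mathcal O_B^{(a^{-1}g_2)}+\mathcal O_B^{(a^{-1}g_2)}\mathcal O_A^{(g_1a^{-1}b^{-1}a^{-1}g_2)}\mathcal O_A^{(g_2)}-\mathcal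 O_B^{(g_2)}\mathcal O_B^{(\sigma(g_1)g_2)}\mathcal O_B^{(g_2)}$; - $\mathcal O_B^{(g_2)}\mathcal O_B^{(g_1b^{-1}a^{-1}b^{-1}g_2)}\mathcal O_A^{(b^{-1}g_2)}+\mathcal O_A^{(b^{-1}g_2)}\mathcal O_B^{(g_1b^{-1}a^{-1}b^{-1}g_2)}\mathcal O_B^{(g_2)}-\mathcal O_A^{(g_2)}\mathcal O_A^{(\sigma(g_1)g_2)}\mathcal O_A^{(g_2)}$. Then $\mathcal A=\mathcal F/\mathcal I$. The group $PSL(2,\mathbb Z)=\langle \mathbf a,\mathbf s\mid \mathbf s^2=(\mathbf a\mathbf s)^3=1\rangle$ acts on $\mathcal A$ by the $\mathbf k$-algebra automorphisms $\mathbf s(\mathcal O_A^{(g)})=\mathcal O_B^{(\sigma(g))}$, $\mathbf s(\mathcal O_B^{(g)})=\mathcal O_A^{(\sigma(g))}$ and $$\mathbf a(\mathcal O_A^{(g)})=-\frac{\mathcal O_A^{(1)}\mathcal O_A^{(ga^{-1})}\mathcal O_A^{(1)}}{(Q^2-Q^{-2})^2},\qquad \mathbf a(\mathcal O_B^{(g)})=\frac{Q\,\mathcal O_A^{(1)}\mathcal O_B^{(ga^{-1})}-Q^{-1}\mathcal O_B^{(ga^{-1})}\mathcal O_A^{(1)}}{Q^2-Q^{-2}}.$$ The Casimir element is $$C=\frac{\mathcal O_B^{(1)}\mathcal O_B^{(1)}\mathcal O_A^{(1)}\mathcal O_A^{(1)}}{(Q^2-Q^{-2})^4}+\frac{\mathcal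 O_A^{(1)}\mathcal O_A^{(1)}+\mathcal O_B^{(1)}\mathcal O_B^{(1)}}{(Q^2-Q^{-2})^2}+1\in\mathcal A ;$$ it is fixed by $\mathbf a$ and $\mathbf s$. The $PSL(2,\mathbb Z)$-action on $\mathcal A_0$ is the one induced from $\mathcal A$. **Spherical DAHA of type $A_1$ at level $K=2$.** The $A_1$ spherical double affine Hecke algebra (DAHA) with parameters $q,t$ is the associative algebra generated by the two difference operators $$\frac{1-tx^2}{1-x^2}\,\delta+\frac{1-tx^{-2}}{1-x^{-2}}\,\delta^{-1},\qquad x+x^{-1},\qquad \delta f(x)=f(q^{1/2}x),$$ acting on functions of one variable $x$. It has finite-dimensional modules when $t=-q^{-K/2}$, $K=1,2,3,\dots$ ("level $K$"). The finite-dimensional representation of the algebra at level $K$ means the quotient of the spherical DAHA by the additional relations that hold in its action on the corresponding module, i.e. the algebra of operators by which it acts on that module. For $K=2$ (with $q=Q^4$, $t=-Q^{-4}$) the module is 3-dimensional, and the matrices by which the two generators act on it (with the first generator suitably rescaled by a constant) are $$\begin{pmatrix}-\mathrm i(Q^2-Q^{-2})&0&0\\0&0&0\\0&0&\mathrm i(Q^2-Q^{-2})\end{pmatrix},\qquad \begin{pmatrix}0&1&0\\-\tfrac12(Q^2-Q^{-2})^2&0&1\\0&-\tfrac12(Q^2-Q^{-2})^2&0\end{pmatrix}\in\mathrm{Mat}_{3\times3}(\mathbf k).$$ The $PSL(2,\mathbb Z)$-action on this side is the standard (Cherednik) action by automorphisms of the spherical DAHA, induced on the level $K=2$ representation: it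 is generated by two automorphisms satisfying $\mathbf a\mathbf b\mathbf a=\mathbf b\mathbf a\mathbf b$, $(\mathbf a\mathbf b\mathbf a)^2=1$, where $\mathbf a$ fixes the first generator and sends the second to a multiple of a $q$-commutator of the two generators, and $\mathbf b$ fixes the second and sends the first to a multiple of a $q$-commutator. *)

theory Defs
  imports
    "HOL-Analysis.Analysis"
    "HOL-Algebra.QuotRing"
    "HOL-Algebra.Generated_Rings"
    "HOL-Library.Poly_Mapping"
    "HOL-Computational_Algebra.Polynomial"
    "HOL-Computational_Algebra.Fraction_Field"
begin

section \<open>The ground field\<close>

type_synonym kfield = "complex poly fract"

definition cconst :: "complex \<Rightarrow> kfield" where
  "cconst z = Fraction_Field.Fract [:z:] 1"

definition QQ :: kfield where
  "QQ = Fraction_Field.Fract [:0, 1:] 1"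

definition dq :: kfield where
  "dq = QQ ^ 2 - 1 / QQ ^ 2"


section \<open>The free group on two generators\<close>

datatype letter = LA | LA_inv | LB | LB_inv

fun linv :: "letter \<Rightarrow> letter" where
  "linv LA = LA_inv" | "linv LA_inv = LA" | "linv LB = LB_inv" | "linv LB_inv = LB"

fun lswap :: "letter \<Rightarrow> letter" where
  "lswap LA = LB" | "lswap LA_inv = LB_inv" | "lswap LB = LA" | "lswap LB_inv = LA_inv"

lemma linv_linv [simp]: "linv (linv l) = l"
  by (cases l) auto

lemma lswap_linv: "lswap (linv l) = linv (lswap l)"
  by (cases l) auto

inductive cancels :: "letter list \<Rightarrow> letter list \<Rightarrow> bool" where
  "cancels (u @ [l, linv l] @ v) (u @ v)"

lemma equivclp_mono_map:
  assumes "equivclp r x y" "\<And>x y. r x y \<Longrightarrow> equivclp r' (f x) (f y)"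
  shows "equivclp r' (f x) (f y)"
  using assms(1)
proof (induction rule: equivclp_induct)
  case (step y z)
  then show ?case
    using assms(2) by (metis equivclp_sym equivclp_trans)
qed simp

quotient_type free2 = "letter list" / "equivclp cancels"
  by simp

lemma cancels_context:
  assumes "cancels x y" shows "cancels (p @ x @ s) (p @ y @ s)"
proof -
  from assms obtain u l v where "x = u @ [l, linv l] @ v" "y = u @ v"
    by (auto elim: cancels.cases)
  then show ?thesis
    using cancels.intros[of "p @ u" l "v @ s"] by simp
qed

lemma equivclp_append:
  assumes "equivclp cancels u u'" "equivclp cancels v v'"
  shows "equivclp cancels (u @ v) (u' @ v')"
proof -
  have "equivclp cancels (u @ v) (u' @ v)"
    by (rule equivclp_mono_map[OF assms(1), of _ "\<lambda>x. x @ v"])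
      (use cancels_context[of _ _ "[]" v] in \<open>auto intro: r_into_equivclp\<close>)
  moreover have "equivclp cancels (u' @ v) (u' @ v')"
    by (rule equivclp_mono_map[OF assms(2), of _ "\<lambda>x. u' @ x"])
      (use cancels_context[of _ _ u' "[]"] in \<open>auto intro: r_into_equivclp\<close>)
  ultimately show ?thesis
    by (rule equivclp_trans)
qed

lemma cancels_rev_linv:
  assumes "cancels x y" shows "cancels (rev (map linv x)) (rev (map linv y))"
proof -
  from assms obtain u l v where "x = u @ [l, linv l] @ v" "y = u @ v"
    by (auto elim: cancels.cases)
  then show ?thesis
    using cancels.intros[of "rev (map linv v)" l "rev (map linv u)"] by simp
qed

lemma cancels_lswap:
  assumes "cancels x y" shows "cancels (map lswap x) (map lswap y)"
proof -
  from assms obtain u l v where "x = u @ [l, linv l] @ v" "y = u @ v"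
    by (auto elim: cancels.cases)
  then show ?thesis
    using cancels.intros[of "map lswap u" "lswap l" "map lswap v"] by (simp add: lswap_linv)
qed

instantiation free2 :: "{monoid_mult, inverse}"
begin

lift_definition one_free2 :: free2 is "[]" .

lift_definition times_free2 :: "free2 \<Rightarrow> free2 \<Rightarrow> free2" is "(@)"
  by (rule equivclp_append)

lift_definition inverse_free2 :: "free2 \<Rightarrow> free2" is "\<lambda>w. rev (map linv w)"
  by (erule equivclp_mono_map) (auto intro: r_into_equivclp cancels_rev_linv)

definition divide_free2 :: "free2 \<Rightarrow> free2 \<Rightarrow> free2" where
  "divide_free2 g h = g * inverse h"

instance
  by standard (transfer; simp)+

end

lemma free2_right_inverse: "(g :: free2) * inverse g = 1"
proof transfer
  fix w show "equivclp cancels (w @ rev (map linv w)) []"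
  proof (induction w rule: rev_induct)
    case (snoc l w)
    have "cancels (w @ [l, linv l] @ rev (map linv w)) (w @ rev (map linv w))"
      by (rule cancels.intros)
    then show ?case
      using snoc by (auto intro: equivclp_trans r_into_equivclp)
  qed simp
qed

lift_definition ga :: free2 is "[LA]" .

lift_definition gb :: free2 is "[LB]" .

lift_definition fswap :: "free2 \<Rightarrow> free2" is "map lswap"
  by (erule equivclp_mono_map) (auto intro: r_into_equivclp cancels_lswap)


section \<open>Algebras over the ground field\<close>

text \<open>
  A unital algebra over \<^typ>\<open>kfield\<close> is represented by a (not necessarily commutative) ring
  \<open>R\<close> together with its structure map \<open>e\<close>, which sends a scalar \<open>c\<close> to \<open>c\<close> times the unit of
  \<open>R\<close>. A ring homomorphism is linear over \<^typ>\<open>kfield\<close> iff it commutes with the structure maps.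
\<close>

definition alg_hom ::
  "('r, 'm) ring_scheme \<Rightarrow> (kfield \<Rightarrow> 'r) \<Rightarrow> ('s, 'n) ring_scheme \<Rightarrow> (kfield \<Rightarrow> 's) \<Rightarrow> ('r \<Rightarrow> 's) set"
where
  "alg_hom R e R' e' = {h \<in> ring_hom R R'. \<forall>c. h (e c) = e' c}"

definition alg_iso ::
  "('r, 'm) ring_scheme \<Rightarrow> (kfield \<Rightarrow> 'r) \<Rightarrow> ('s, 'n) ring_scheme \<Rightarrow> (kfield \<Rightarrow> 's) \<Rightarrow> ('r \<Rightarrow> 's) set"
where
  "alg_iso R e R' e' = {h \<in> alg_hom R e R' e'. bij_betw h (carrier R) (carrier R')}"

definition subalg_gen ::
  "('r, 'm) ring_scheme \<Rightarrow> (kfield \<Rightarrow> 'r) \<Rightarrow> 'r set \<Rightarrow> ('r, 'm) ring_scheme"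
where
  "subalg_gen R e G = R\<lparr>carrier := generate_ring R (range e \<union> G)\<rparr>"

definition qcomm ::
  "('r, 'm) ring_scheme \<Rightarrow> (kfield \<Rightarrow> 'r) \<Rightarrow> 'r \<Rightarrow> 'r \<Rightarrow> 'r"
where
  "qcomm R e x y =
     e (1 / dq) \<otimes>\<^bsub>R\<^esub> ((e QQ \<otimes>\<^bsub>R\<^esub> (x \<otimes>\<^bsub>R\<^esub> y)) \<ominus>\<^bsub>R\<^esub> (e (1 / QQ) \<otimes>\<^bsub>R\<^esub> (y \<otimes>\<^bsub>R\<^esub> x)))"

definition induces :: "('r, 'm) ring_scheme \<Rightarrow> ('r \<Rightarrow> 's) \<Rightarrow> ('r \<Rightarrow> 'r) \<Rightarrow> ('s \<Rightarrow> 's) \<Rightarrow> bool" where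
  "induces R p f g \<longleftrightarrow> (\<forall>x \<in> carrier R. p (f x) = g (p x))"


section \<open>The algebra of the generators \<open>O\<^sub>A\<close>, \<open>O\<^sub>B\<close> and its Casimir quotient\<close>

datatype side = SideA | SideB

type_synonym gen = "side \<times> free2"

text \<open>Lists form the free monoid, so finitely supported functions on them form the free algebra.\<close>

instantiation list :: (type) monoid_add
begin

definition zero_list :: "'a list" where
  "zero_list = []"

definition plus_list :: "'a list \<Rightarrow> 'a list \<Rightarrow> 'a list" where
  "plus_list = (@)"

instance
  by standard (simp_all add: zero_list_def plus_list_def)

end

type_synonym falg = "gen list \<Rightarrow>\<^sub>0 kfield"

definition F_ring :: "falg ring" where
  "F_ring = \<lparr>carrier = UNIV, mult = (*), one = 1, zero = 0, add = (+)\<rparr>"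

definition F_const :: "kfield \<Rightarrow> falg" where
  "F_const c = Poly_Mapping.single [] c"

definition Og :: "side \<Rightarrow> free2 \<Rightarrow> falg" where
  "Og X g = Poly_Mapping.single [(X, g)] 1"

abbreviation OA :: "free2 \<Rightarrow> falg" where "OA \<equiv> Og SideA"
abbreviation OB :: "free2 \<Rightarrow> falg" where "OB \<equiv> Og SideB"

inductive_set relators :: "falg set" where
  inv_A: "OA (ga * g) - OA g \<in> relators"
| inv_B: "OB (gb * g) - OB g \<in> relators"
| square: "Og X g * Og X g - Og X 1 * Og X 1 \<in> relators"
| BAB: "OB g1 * OA g2 * OB g3 \<in> relators"
| ABA: "OA g1 * OB g2 * OA g3 \<in> relators"
| cube_left: "Og X 1 * Og X 1 * Og X g + F_const (dq ^ 2) * Og X g \<in> relators"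
| cube_right: "Og X g * Og X 1 * Og X 1 + F_const (dq ^ 2) * Og X g \<in> relators"
| AAB: "OA 1 * OA 1 * OB g + F_const (dq ^ 2) * OB g + OB g * OA 1 * OA 1 \<in> relators"
| BBA: "OB 1 * OB 1 * OA g + F_const (dq ^ 2) * OA g + OA g * OB 1 * OB 1 \<in> relators"
| braid_A: "OA g2 * OA (g1 * ga * gb * ga * g2) * OB (ga * g2)
     + OB (ga * g2) * OA (g1 * ga * gb * ga * g2) * OA g2
     - OB g2 * OB (fswap g1 * g2) * OB g2 \<in> relators"
| braid_B: "OB g2 * OB (g1 * gb * ga * gb * g2) * OA (gb * g2)
     + OA (gb * g2) * OB (g1 * gb * ga * gb * g2) * OB g2
     - OA g2 * OA (fswap g1 * g2) * OA g2 \<in> relators"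
| braid_A_inv: "OA g2 * OA (g1 * inverse ga * inverse gb * inverse ga * g2) * OB (inverse ga * g2)
     + OB (inverse ga * g2) * OA (g1 * inverse ga * inverse gb * inverse ga * g2) * OA g2
     - OB g2 * OB (fswap g1 * g2) * OB g2 \<in> relators"
| braid_B_inv: "OB g2 * OB (g1 * inverse gb * inverse ga * inverse gb * g2) * OA (inverse gb * g2)
     + OA (inverse gb * g2) * OB (g1 * inverse gb * inverse ga * inverse gb * g2) * OB g2
     - OA g2 * OA (fswap g1 * g2) * OA g2 \<in> relators"

definition I_ideal :: "falg set" where
  "I_ideal = Idl\<^bsub>F_ring\<^esub> relators"

definition A_ring :: "falg set ring" where
  "A_ring = F_ring Quot I_ideal"

definition A_proj :: "falg \<Rightarrow> falg set" where
  "A_proj x = I_ideal +>\<^bsub>F_ring\<^esub> x"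

definition A_const :: "kfield \<Rightarrow> falg set" where
  "A_const c = A_proj (F_const c)"

definition A_gen :: "side \<Rightarrow> free2 \<Rightarrow> falg set" where
  "A_gen X g = A_proj (Og X g)"

definition casimir :: "falg set" where
  "casimir = A_proj
     (F_const (1 / dq ^ 4) * (OB 1 * OB 1 * OA 1 * OA 1)
      + F_const (1 / dq ^ 2) * (OA 1 * OA 1 + OB 1 * OB 1) + 1)"

definition J_ideal :: "falg set set" where
  "J_ideal = Idl\<^bsub>A_ring\<^esub> ({casimir} \<union> {A_gen X g \<ominus>\<^bsub>A_ring\<^esub> A_gen X 1 | X g. True})"

definition A0_ring :: "falg set set ring" where
  "A0_ring = A_ring Quot J_ideal"

definition A0_proj :: "falg set \<Rightarrow> falg set set" where
  "A0_proj x = J_ideal +>\<^bsub>A_ring\<^esub> x"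

definition A0_const :: "kfield \<Rightarrow> falg set set" where
  "A0_const c = A0_proj (A_const c)"

definition A0_gen :: "side \<Rightarrow> free2 \<Rightarrow> falg set set" where
  "A0_gen X g = A0_proj (A_gen X g)"

text \<open>
  The modular group is given by its presentation with generators \<open>a\<close>, \<open>s\<close> and relations
  \<open>s\<^sup>2 = (a s)\<^sup>3 = 1\<close>, so an action is a pair of automorphisms satisfying these relations. The
  predicate fixes the values on the generators \<open>o X g\<close> of an algebra (used for both
  \<^term>\<open>A_ring\<close> and \<^term>\<open>A0_ring\<close>), and hence determines the action.
\<close>

definition modular_action ::
  "('r, 'm) ring_scheme \<Rightarrow> (kfield \<Rightarrow> 'r) \<Rightarrow> (side \<Rightarrow> free2 \<Rightarrow> 'r) \<Rightarrow> ('r \<Rightarrow> 'r) \<Rightarrow> ('r \<Rightarrow> 'r) \<Rightarrow> bool"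
where
  "modular_action R e ob a s \<longleftrightarrow>
     a \<in> alg_iso R e R e \<and> s \<in> alg_iso R e R e \<and>
     (\<forall>x \<in> carrier R. s (s x) = x) \<and>
     (\<forall>x \<in> carrier R. a (s (a (s (a (s x))))) = x) \<and>
     (\<forall>g. s (ob SideA g) = ob SideB (fswap g)) \<and>
     (\<forall>g. s (ob SideB g) = ob SideA (fswap g)) \<and>
     (\<forall>g. a (ob SideA g) =
        e (- 1 / dq ^ 2) \<otimes>\<^bsub>R\<^esub> (ob SideA 1 \<otimes>\<^bsub>R\<^esub> ob SideA (g * inverse ga) \<otimes>\<^bsub>R\<^esub> ob SideA 1)) \<and>
     (\<forall>g. a (ob SideB g) = qcomm R e (ob SideA 1) (ob SideB (g * inverse ga)))"


section \<open>The spherical double affine Hecke algebra of type \<open>A\<^sub>1\<close>\<close>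

text \<open>The functions acted upon are the rational functions of \<open>x\<close> over \<^typ>\<open>kfield\<close>.\<close>

type_synonym xfield = "kfield poly fract"

definition xconst :: "kfield \<Rightarrow> xfield" where
  "xconst c = Fraction_Field.Fract [:c:] 1"

definition xvar :: xfield where
  "xvar = Fraction_Field.Fract [:0, 1:] 1"

text \<open>The substitution \<open>f(x) \<mapsto> f(r x)\<close>; well defined for \<open>r \<noteq> 0\<close>.\<close>

definition qshift :: "kfield \<Rightarrow> xfield \<Rightarrow> xfield" where
  "qshift r f = (THE g. \<exists>p d. d \<noteq> 0 \<and> f = Fraction_Field.Fract p d \<and>
     g = Fraction_Field.Fract (pcompose p [:0, r:]) (pcompose d [:0, r:]))"

definition End_ring :: "(xfield \<Rightarrow> xfield) ring" where
  "End_ring = \<lparr>carrier = {T. (\<forall>f g. T (f + g) = T f + T g) \<and> (\<forall>c f. T (xconst c * f) = xconst c * T f)},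
     mult = (\<circ>), one = id, zero = (\<lambda>f. 0), add = (\<lambda>S T f. S f + T f)\<rparr>"

definition op_const :: "kfield \<Rightarrow> xfield \<Rightarrow> xfield" where
  "op_const c f = xconst c * f"

text \<open>The parameter \<open>r\<close> stands for \<open>q\<^bsup>1/2\<^esup>\<close>.\<close>

definition daha_D :: "kfield \<Rightarrow> kfield \<Rightarrow> xfield \<Rightarrow> xfield" where
  "daha_D r t f =
     (1 - xconst t * xvar ^ 2) / (1 - xvar ^ 2) * qshift r f
     + (1 - xconst t * (1 / xvar ^ 2)) / (1 - 1 / xvar ^ 2) * qshift (1 / r) f"

definition daha_Y :: "xfield \<Rightarrow> xfield" where
  "daha_Y f = (xvar + 1 / xvar) * f"

definition SDAHA :: "kfield \<Rightarrow> kfield \<Rightarrow> (xfield \<Rightarrow> xfield) ring" where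
  "SDAHA r t = subalg_gen End_ring op_const {daha_D r t, daha_Y}"

text \<open>With \<open>q = Q\<^sup>4\<close>, level \<open>K\<close> means \<open>t = - q\<^bsup>-K/2\<^esup>\<close>.\<close>

definition level_t :: "nat \<Rightarrow> kfield" where
  "level_t K = - 1 / (QQ ^ 2) ^ K"

abbreviation S2_ring :: "(xfield \<Rightarrow> xfield) ring" where
  "S2_ring \<equiv> SDAHA (QQ ^ 2) (level_t 2)"

text \<open>
  The first generator is rescaled by \<open>- \<i> Q\<^sup>2\<close>, a square root of \<open>1 / t\<close>: the eigenvalue
  \<open>1 + t\<close> of \<^const>\<open>daha_D\<close> on constant functions becomes the upper left entry of \<open>matX\<close> below.
\<close>

definition S2_X :: "xfield \<Rightarrow> xfield" where
  "S2_X = op_const (- (cconst \<i> * QQ ^ 2)) \<circ> daha_D (QQ ^ 2) (level_t 2)"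

definition matX :: "kfield ^ 3 ^ 3" where
  "matX = vector [vector [- (cconst \<i> * dq), 0, 0],
                  vector [0, 0, 0],
                  vector [0, 0, cconst \<i> * dq]]"

definition matY :: "kfield ^ 3 ^ 3" where
  "matY = vector [vector [0, 1, 0],
                  vector [- (1 / 2) * dq ^ 2, 0, 1],
                  vector [0, - (1 / 2) * dq ^ 2, 0]]"

definition Mat3_ring :: "(kfield ^ 3 ^ 3) ring" where
  "Mat3_ring = \<lparr>carrier = UNIV, mult = (**), one = mat 1, zero = 0, add = (+)\<rparr>"

text \<open>\<^term>\<open>rho\<close> is the action of the spherical DAHA on the module of dimension 3 at level 2.\<close>

definition level2_module :: "((xfield \<Rightarrow> xfield) \<Rightarrow> kfield ^ 3 ^ 3) \<Rightarrow> bool" where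
  "level2_module rho \<longleftrightarrow> rho \<in> alg_hom S2_ring op_const Mat3_ring mat
     \<and> rho S2_X = matX \<and> rho daha_Y = matY"

definition level2_algebra ::
  "((xfield \<Rightarrow> xfield) \<Rightarrow> kfield ^ 3 ^ 3) \<Rightarrow> (kfield ^ 3 ^ 3) ring"
where
  "level2_algebra rho = Mat3_ring\<lparr>carrier := rho ` carrier S2_ring\<rparr>"

text \<open>
  The Cherednik action, specified on an algebra with generators \<open>x\<close>, \<open>y\<close> (used for the spherical
  DAHA and for its representation). The element \<open>s\<close> of the modular group is \<open>a b a\<close>, so that
  \<open>b = s a s\<close>.
\<close>

definition cherednik_action ::
  "('r, 'm) ring_scheme \<Rightarrow> (kfield \<Rightarrow> 'r) \<Rightarrow> 'r \<Rightarrow> 'r \<Rightarrow> ('r \<Rightarrow> 'r) \<Rightarrow> ('r \<Rightarrow> 'r) \<Rightarrow> bool"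
where
  "cherednik_action R e x y a b \<longleftrightarrow>
     a \<in> alg_iso R e R e \<and> b \<in> alg_iso R e R e \<and>
     (\<forall>z \<in> carrier R. a (b (a z)) = b (a (b z))) \<and>
     (\<forall>z \<in> carrier R. a (b (a (a (b (a z))))) = z) \<and>
     a x = x \<and> a y = qcomm R e x y \<and>
     b y = y \<and> b x = qcomm R e y x"

end

theory Submission
  imports Defs
begin

text \<open>
  Evaluating \<open>O\<^sub>A\<close> and \<open>O\<^sub>B\<close> at \<^const>\<open>matX\<close> and \<^const>\<open>matY\<close> respects all relations of the
  Casimir quotient, and the two matrices generate the full matrix algebra of dimension 9. Conversely,
  modulo the relations the quotient is spanned by the nine words \<open>1, A, B, A\<^sup>2, B\<^sup>2, AB, BA, A\<^sup>2B, B\<^sup>2A\<close>,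
  whose values are linearly independent. So the quotient is the matrix algebra, on which the modular
  group acts by conjugations.

  On the other side, at \<open>t = - q\<^sup>-\<^sup>1\<close> the values of a function at the three points \<open>\<i> Q\<^sup>-\<^sup>2, \<i>, \<i> Q\<^sup>2\<close> determine
  the values of its image under the difference operator at these points, because the coefficients of the
  shifts that lead out of the three points vanish. In suitable coordinates of the space of triples of values
  the two generators act by \<^const>\<open>matX\<close> and \<^const>\<open>matY\<close>. Hence the image of the spherical DAHA is
  again the full matrix algebra.
\<close>

section \<open>The ground field\<close>

lemma cconst_add: "cconst (x + y) = cconst x + cconst y"
  by (simp add: cconst_def)

lemma cconst_mult: "cconst (x * y) = cconst x * cconst y"
  by (simp add: cconst_def mult.commute)

lemma cconst_one: "cconst 1 = 1"
  by (simp add: cconst_def One_fract_def pCons_one)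

lemma cconst_uminus: "cconst (- x) = - cconst x"
  by (simp add: cconst_def)

lemma cconst_eq_0: "cconst x = 0 \<longleftrightarrow> x = 0"
  by (simp add: cconst_def Zero_fract_def eq_fract)

lemma cconst_ii_sq: "cconst \<i> * cconst \<i> = - 1"
  by (metis cconst_mult cconst_one cconst_uminus i_squared power2_eq_square)

lemma cconst_numeral: "cconst (numeral n) = numeral n"
  by (induction n) (simp_all only: numeral.simps cconst_add cconst_one)

lemma numeral_kfield_nz: "(numeral n :: kfield) \<noteq> 0"
  by (metis cconst_eq_0 cconst_numeral zero_neq_numeral)

lemma QQ_power: "QQ ^ n = Fraction_Field.Fract (Polynomial.monom 1 n) 1"
proof (induction n)
  case (Suc n)
  then show ?case by (simp add: QQ_def monom_Suc)
qed (simp add: One_fract_def)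

lemma QQ_nz: "QQ \<noteq> 0"
  by (simp add: QQ_def Zero_fract_def eq_fract)

text \<open>\<open>QQ\<close> is transcendental over the complex numbers: a monomial of positive
  degree is not a constant polynomial. The nonvanishing of \<open>dq\<close> and of the denominators
  of the difference operator rests on this.\<close>

lemma QQ_power_ne:
  assumes "n > 0" shows "QQ ^ n \<noteq> cconst c"
proof
  assume "QQ ^ n = cconst c"
  then have "Polynomial.monom 1 n = [:c:]"
    by (simp add: QQ_power cconst_def eq_fract)
  then have "degree (Polynomial.monom (1::complex) n) = 0" by simp
  then show False using assms by (simp add: degree_monom_eq)
qed

lemma dq_nz: "dq \<noteq> 0"
proof
  assume "dq = 0"
  then have "QQ ^ 2 * QQ ^ 2 = 1"
    using QQ_nz by (simp add: dq_def field_simps)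
  then show False using QQ_power_ne[of 4 1] by (simp add: cconst_one flip: power_add)
qed

section \<open>Matrices over the ground field\<close>

lemma matrix_add_rdistrib: "(A + B) ** C = A ** C + B ** (C :: 'a :: semiring_1 ^ 'n ^ 'm)"
  by (simp add: vec_eq_iff matrix_matrix_mult_def distrib_right sum.distrib)

lemma ring_Mat3: "ring Mat3_ring"
proof (rule ringI)
  show "abelian_group Mat3_ring"
  proof (rule abelian_groupI)
    show "\<exists>y\<in>carrier Mat3_ring. y \<oplus>\<^bsub>Mat3_ring\<^esub> x = \<zero>\<^bsub>Mat3_ring\<^esub>" for x
      by (auto simp: Mat3_ring_def intro: left_minus)
  qed (auto simp: Mat3_ring_def)
  show "Group.monoid Mat3_ring"
    by (rule monoidI) (auto simp: Mat3_ring_def matrix_mul_assoc)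
qed (auto simp: Mat3_ring_def matrix_add_ldistrib matrix_add_rdistrib)

lemma Mat3_simps [simp]:
  "carrier Mat3_ring = UNIV" "x \<otimes>\<^bsub>Mat3_ring\<^esub> y = x ** y" "\<one>\<^bsub>Mat3_ring\<^esub> = mat 1"
  "\<zero>\<^bsub>Mat3_ring\<^esub> = 0" "x \<oplus>\<^bsub>Mat3_ring\<^esub> y = x + y"
  by (simp_all add: Mat3_ring_def)

lemma Mat3_minus [simp]: "\<ominus>\<^bsub>Mat3_ring\<^esub> x = - x" "x \<ominus>\<^bsub>Mat3_ring\<^esub> y = x - y"
proof -
  interpret ring Mat3_ring by (rule ring_Mat3)
  show *: "\<ominus>\<^bsub>Mat3_ring\<^esub> x = - x" for x
    by (rule minus_equality) auto
  show "x \<ominus>\<^bsub>Mat3_ring\<^esub> y = x - y"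
    by (simp add: a_minus_def *)
qed

lemmas mat3_eval = vec_eq_iff forall_3 matrix_matrix_mult_def sum_3 vector_3 mat_def

lemma mat_matrix_mult: "mat c ** M = (\<chi> i j. c * M $ i $ j)"
  by (simp add: vec_eq_iff matrix_matrix_mult_def mat_def if_distribR if_distrib[of "\<lambda>x. x * _"]
      cong: if_cong)

lemma matrix_mult_mat: "M ** mat c = (\<chi> i j. M $ i $ j * c)"
  by (simp add: vec_eq_iff matrix_matrix_mult_def mat_def if_distribR if_distrib[of "\<lambda>x. _ * x"]
      cong: if_cong)

lemma mat_commute: "mat c ** M = M ** mat (c :: 'a :: comm_semiring_1)"
  by (simp add: mat_matrix_mult matrix_mult_mat mult.commute)

lemma mat_mult: "mat c ** mat d = mat (c * (d :: 'a :: semiring_1))"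
  unfolding mat_matrix_mult by (simp add: vec_eq_iff mat_def)

lemma mat_add: "mat c + mat d = mat (c + (d :: 'a :: semiring_1))"
  by (simp add: vec_eq_iff mat_def)

text \<open>The square of the imaginary unit in right-nested form, so that simplification still
  finds it inside reassociated products.\<close>

lemma cconst_ii_mult_left: "cconst \<i> * (cconst \<i> * x) = - x"
  using cconst_ii_sq by (simp flip: mult.assoc)

lemmas mat3_calc = mat3_eval cconst_ii_sq cconst_ii_mult_left numeral_kfield_nz dq_nz QQ_nz field_simps
  power2_eq_square power4_eq_xxxx

text \<open>These are the defining relations with all superscripts forgotten: the four braid
  families collapse to two, and the last equation is the vanishing of the Casimir element.\<close>

lemma matX_matY_relations:
  "matX ** matX ** matX + mat (dq ^ 2) ** matX = 0"
  "matY ** matY ** matY + mat (dq ^ 2) ** matY = 0"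
  "matX ** matY ** matX = 0"
  "matY ** matX ** matY = 0"
  "matX ** matX ** matY + mat (dq ^ 2) ** matY + matY ** matX ** matX = 0"
  "matY ** matY ** matX + mat (dq ^ 2) ** matX + matX ** matY ** matY = 0"
  "matX ** matX ** matY + matY ** matX ** matX - matY ** matY ** matY = 0"
  "matY ** matY ** matX + matX ** matY ** matY - matX ** matX ** matX = 0"
  "mat (1 / dq ^ 4) ** (matY ** matY ** matX ** matX)
    + mat (1 / dq ^ 2) ** (matX ** matX + matY ** matY) + mat 1 = 0"
  by (simp_all add: matX_def matY_def mat3_calc)

text \<open>The diagonal matrix \<open>matX\<close> has three distinct eigenvalues, so polynomials
  in it give the diagonal idempotents. Sandwiching \<open>matY\<close> or its square between two of
  them gives nonzero multiples of the remaining matrix units. Hence scalars, \<open>matX\<close> and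
  \<open>matY\<close> generate all matrices.\<close>

lemma matX_matY_induct:
  assumes "\<And>c. P (mat c)" "P matX" "P matY"
    and "\<And>M N. P M \<Longrightarrow> P N \<Longrightarrow> P (M + N)" "\<And>M N. P M \<Longrightarrow> P N \<Longrightarrow> P (M ** N)"
  shows "P M"
proof -
  \<comment> \<open>Lagrange interpolation polynomials for the eigenvalues minus i dq, 0 and i dq,
    evaluated at \<open>matX\<close>.\<close>
  define E1 where "E1 = mat (1 / 2) ** (mat (- 1 / dq ^ 2) ** matX ** matX + mat (cconst \<i> / dq) ** matX)"
  define E2 where "E2 = mat 1 + mat (1 / dq ^ 2) ** matX ** matX"
  define E3 where "E3 = mat (1 / 2) ** (mat (- 1 / dq ^ 2) ** matX ** matX + mat (- (cconst \<i> / dq)) ** matX)"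
  have E1: "E1 = vector [vector [1, 0, 0], vector [0, 0, 0], vector [0, 0, 0]]"
    by (simp add: E1_def matX_def mat3_calc)
  have E2: "E2 = vector [vector [0, 0, 0], vector [0, 1, 0], vector [0, 0, 0]]"
    by (simp add: E2_def matX_def mat3_calc)
  have E3: "E3 = vector [vector [0, 0, 0], vector [0, 0, 0], vector [0, 0, 1]]"
    by (simp add: E3_def matX_def mat3_calc)
  \<comment> \<open>\<open>matY\<close> is tridiagonal with zero diagonal, so the two corner units
    need two factors \<open>matY\<close>. The inverses of the entries found here give the
    coefficients in the expansion of \<open>M\<close>.\<close>
  have unit:
    "E1 ** matY ** E2 = vector [vector [0, 1, 0], 0, 0]"
    "E2 ** matY ** E3 = vector [0, vector [0, 0, 1], 0]"
    "E2 ** matY ** E1 = vector [0, vector [- (1 / 2) * dq ^ 2, 0, 0], 0]"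
    "E3 ** matY ** E2 = vector [0, 0, vector [0, - (1 / 2) * dq ^ 2, 0]]"
    "E1 ** matY ** matY ** E3 = vector [vector [0, 0, 1], 0, 0]"
    "E3 ** matY ** matY ** E1 = vector [0, 0, vector [dq ^ 4 / 4, 0, 0]]"
    unfolding E1 E2 E3 by (simp_all add: matY_def mat3_calc)
  have "M = mat (M $ 1 $ 1) ** E1 + mat (M $ 2 $ 2) ** E2 + mat (M $ 3 $ 3) ** E3
     + mat (M $ 1 $ 2) ** (E1 ** matY ** E2) + mat (M $ 2 $ 3) ** (E2 ** matY ** E3)
     + mat (- 2 / dq ^ 2 * M $ 2 $ 1) ** (E2 ** matY ** E1)
     + mat (- 2 / dq ^ 2 * M $ 3 $ 2) ** (E3 ** matY ** E2)
     + mat (M $ 1 $ 3) ** (E1 ** matY ** matY ** E3)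
     + mat (4 / dq ^ 4 * M $ 3 $ 1) ** (E3 ** matY ** matY ** E1)" (is "M = ?rhs")
    unfolding unit unfolding E1 E2 E3 mat_matrix_mult
    by (simp add: vec_eq_iff forall_3 vector_3 dq_nz numeral_kfield_nz)
  moreover have "P E1" "P E2" "P E3"
    by (auto simp: E1_def E2_def E3_def intro!: assms)
  then have "P ?rhs"
    by (intro assms)
  ultimately show ?thesis
    by simp
qed

section \<open>Homomorphisms of algebras\<close>

lemma alg_homI:
  assumes "h \<in> ring_hom R S" "\<And>c. h (e c) = e' c"
  shows "h \<in> alg_hom R e S e'"
  using assms by (simp add: alg_hom_def)

lemma alg_homD:
  assumes "h \<in> alg_hom R e S e'"
  shows "h \<in> ring_hom R S" "h (e c) = e' c"
  using assms by (simp_all add: alg_hom_def)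

lemma alg_isoD:
  assumes "h \<in> alg_iso R e S e'"
  shows "h \<in> alg_hom R e S e'" "h \<in> ring_hom R S" "h (e c) = e' c" "bij_betw h (carrier R) (carrier S)"
  using assms by (simp_all add: alg_iso_def alg_hom_def)

lemma alg_iso_iff: "h \<in> alg_iso R e S e' \<longleftrightarrow> h \<in> ring_iso R S \<and> (\<forall>c. h (e c) = e' c)"
  by (auto simp: alg_iso_def alg_hom_def ring_iso_def)

lemma alg_iso_comp:
  assumes "f \<in> alg_iso R e S e'" "g \<in> alg_iso S e' T e''"
  shows "g \<circ> f \<in> alg_iso R e T e''"
  using assms ring_iso_set_trans[of f R S g T] by (auto simp: alg_iso_iff)

lemma alg_iso_inv:
  assumes "ring R" "f \<in> alg_iso R e S e'" "range e \<subseteq> carrier R"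
  shows "inv_into (carrier R) f \<in> alg_iso S e' R e"
proof -
  have "inv_into (carrier R) f (e' c) = e c" for c
    using assms(2,3) inv_into_f_f[of f "carrier R" "e c"]
    by (auto simp: alg_iso_def alg_hom_def bij_betw_def)
  then show ?thesis
    using assms ring_iso_set_sym[of R f S] by (auto simp: alg_iso_iff)
qed

lemma ring_hom_minus:
  assumes "h \<in> ring_hom R S" "ring R" "ring S" "x \<in> carrier R" "y \<in> carrier R"
  shows "h (\<ominus>\<^bsub>R\<^esub> x) = \<ominus>\<^bsub>S\<^esub> h x" "h (x \<ominus>\<^bsub>R\<^esub> y) = h x \<ominus>\<^bsub>S\<^esub> h y"
proof -
  interpret ring_hom_ring R S h
    using assms by (intro ring_hom_ringI2)
  show "h (\<ominus>\<^bsub>R\<^esub> x) = \<ominus>\<^bsub>S\<^esub> h x" "h (x \<ominus>\<^bsub>R\<^esub> y) = h x \<ominus>\<^bsub>S\<^esub> h y"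
    using assms by (auto simp: a_minus_def)
qed

lemma qcomm_closed:
  assumes "ring R" "range e \<subseteq> carrier R" "x \<in> carrier R" "y \<in> carrier R"
  shows "qcomm R e x y \<in> carrier R"
proof -
  interpret ring R by fact
  have [simp]: "e c \<in> carrier R" for c
    using assms by auto
  show ?thesis
    using assms by (simp add: qcomm_def)
qed

text \<open>The actions are specified through q-commutators, so this is what carries their defining
  formulas along homomorphisms.\<close>

lemma alg_hom_qcomm:
  assumes h: "h \<in> alg_hom R e S e'" and R: "ring R" "ring S" "range e \<subseteq> carrier R"
    and xy: "x \<in> carrier R" "y \<in> carrier R"
  shows "h (qcomm R e x y) = qcomm S e' (h x) (h y)"
proof -
  interpret ring R by fact
  note hom = alg_homD[OF h]
  have [simp]: "e c \<in> carrier R" for c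
    using R by auto
  show ?thesis
    using xy by (simp add: qcomm_def ring_hom_minus[OF hom(1) R(1,2)] ring_hom_mult[OF hom(1)] hom(2))
qed

section \<open>The modular action on matrices\<close>

lemma inner_alg_iso:
  assumes "U ** V = mat 1" "V ** U = mat 1"
  shows "(\<lambda>M. U ** M ** V) \<in> alg_iso Mat3_ring mat Mat3_ring mat"
proof -
  have VU: "V ** (U ** M) = M" "U ** (V ** M) = M" for M :: "kfield ^ 3 ^ 3"
    using assms by (simp_all add: matrix_mul_assoc)
  have "bij (\<lambda>M. U ** M ** V)"
    by (rule bij_betw_byWitness[of _ "\<lambda>M. V ** M ** U"])
      (auto simp: VU assms simp flip: matrix_mul_assoc)
  moreover have "(\<lambda>M. U ** M ** V) \<in> ring_hom Mat3_ring Mat3_ring"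
    by (rule ring_hom_memI)
      (auto simp: VU assms matrix_add_ldistrib matrix_add_rdistrib simp flip: matrix_mul_assoc)
  moreover have "U ** mat c ** V = mat c" for c
    by (metis assms(1) mat_commute matrix_mul_assoc matrix_mul_rid)
  ultimately show ?thesis
    by (simp add: alg_iso_def alg_hom_def)
qed

text \<open>
  Since \<^const>\<open>matX\<close> is diagonal with entries \<open>x\<^sub>i\<close>, the matrix \<open>qcomm matX matY\<close> arises from \<^const>\<open>matY\<close> by scaling
  the entry at \<open>(i, j)\<close> by \<open>(Q x\<^sub>i - Q\<^sup>-\<^sup>1 x\<^sub>j) / dq\<close>, which is a conjugation by a diagonal matrix.
\<close>

definition conj_a :: "kfield ^ 3 ^ 3 \<Rightarrow> kfield ^ 3 ^ 3" where
  "conj_a M = vector [vector [- (cconst \<i> * QQ), 0, 0], vector [0, 1, 0], vector [0, 0, cconst \<i> * QQ]] ** M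
     ** vector [vector [cconst \<i> / QQ, 0, 0], vector [0, 1, 0], vector [0, 0, - (cconst \<i> / QQ)]]"

text \<open>
  The columns are eigenvectors of \<^const>\<open>matY\<close> for the diagonal entries of \<^const>\<open>matX\<close>, scaled such that
  conjugation exchanges \<^const>\<open>matX\<close> and \<^const>\<open>matY\<close>.
\<close>

definition matS :: "kfield ^ 3 ^ 3" where
  "matS = vector [vector [1, 2 * cconst \<i> / dq, - 2 / dq ^ 2],
                  vector [- (cconst \<i> * dq), 0, - 2 * cconst \<i> / dq],
                  vector [- (1 / 2) * dq ^ 2, cconst \<i> * dq, 1]]"

text \<open>Conjugation by \<open>matS\<close>: the square of \<open>matS\<close> is the scalar 4,
  so its inverse is \<open>matS\<close> divided by 4.\<close>

definition conj_s :: "kfield ^ 3 ^ 3 \<Rightarrow> kfield ^ 3 ^ 3" where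
  "conj_s M = mat (1 / 4) ** matS ** M ** matS"

lemma conj_a_iso: "conj_a \<in> alg_iso Mat3_ring mat Mat3_ring mat"
  unfolding conj_a_def by (rule inner_alg_iso) (simp_all add: mat3_calc)

lemma matS_sq: "matS ** matS = mat 4"
  by (simp add: matS_def mat3_calc)

lemma conj_s_iso: "conj_s \<in> alg_iso Mat3_ring mat Mat3_ring mat"
  unfolding conj_s_def
proof (rule inner_alg_iso)
  have "mat (1 / 4) ** mat 4 = (mat 1 :: kfield ^ 3 ^ 3)"
    using numeral_kfield_nz by (simp add: mat_mult field_simps)
  then show "mat (1 / 4) ** matS ** matS = mat 1"
    by (simp add: matS_sq flip: matrix_mul_assoc)
  then show "matS ** (mat (1 / 4) ** matS) = mat 1"
    by (metis mat_commute matrix_mul_assoc)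
qed

lemma conj_a_gen: "conj_a matX = matX" "conj_a matY = qcomm Mat3_ring mat matX matY"
  by (simp_all add: qcomm_def conj_a_def matX_def matY_def mat3_calc)

lemma matS_gen: "matS ** matX = matY ** matS" "matS ** matY = matX ** matS"
  by (simp_all add: matS_def matX_def matY_def mat3_calc)

lemma conj_s_gen: "conj_s matX = matY" "conj_s matY = matX"
proof -
  have *: "mat (1 / 4) ** (M ** matS) ** matS = M" for M
  proof -
    have "mat (1 / 4) ** (M ** matS) ** matS = mat (1 / 4) ** (M ** mat 4)"
      by (simp add: matS_sq flip: matrix_mul_assoc)
    also have "\<dots> = M"
      using numeral_kfield_nz[of "num.Bit0 (num.Bit0 num.One)"]
      by (simp add: matrix_mul_assoc mat_mult flip: mat_commute[of 4])
    finally show ?thesis .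
  qed
  show "conj_s matX = matY" "conj_s matY = matX"
    using *[of matX] *[of matY] by (simp_all add: conj_s_def matS_gen flip: matrix_mul_assoc)
qed

text \<open>Scalars, \<open>matX\<close> and \<open>matY\<close> generate the matrix algebra. The
  relations of the modular group can thus be checked on two matrices.\<close>

lemma Mat3_hom_eqI:
  assumes h: "h \<in> alg_hom Mat3_ring mat R e" "h' \<in> alg_hom Mat3_ring mat R e"
    and eq: "h matX = h' matX" "h matY = h' matY"
  shows "h M = h' M"
proof (induction M rule: matX_matY_induct)
  case (1 c)
  show ?case unfolding alg_homD(2)[OF h(1)] alg_homD(2)[OF h(2)] ..
next
  case (4 M N)
  show ?case
    using ring_hom_add[OF alg_homD(1)[OF h(1)], of M N] ring_hom_add[OF alg_homD(1)[OF h(2)], of M N]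
    unfolding Mat3_simps 4 by simp
next
  case (5 M N)
  show ?case
    using ring_hom_mult[OF alg_homD(1)[OF h(1)], of M N] ring_hom_mult[OF alg_homD(1)[OF h(2)], of M N]
    unfolding Mat3_simps 5 by simp
qed (fact eq)+

lemma Mat3_hom_qcomm:
  assumes "h \<in> alg_iso Mat3_ring mat Mat3_ring mat"
  shows "h (qcomm Mat3_ring mat M N) = qcomm Mat3_ring mat (h M) (h N)"
  by (rule alg_hom_qcomm[OF alg_isoD(1)[OF assms] ring_Mat3 ring_Mat3]) simp_all

text \<open>This closes a cycle of length three: \<open>conj_a \<circ> conj_s\<close> sends
  \<open>matY\<close> to \<open>matX\<close>, \<open>matX\<close> to their q-commutator, and the
  q-commutator back to \<open>matY\<close>.\<close>

lemma qcomm_qcomm: "qcomm Mat3_ring mat (qcomm Mat3_ring mat matX matY) matX = matY"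
  by (simp add: qcomm_def matX_def matY_def mat3_calc)

lemma conj_s_s: "conj_s (conj_s M) = M"
proof -
  have "conj_s \<circ> conj_s \<in> alg_hom Mat3_ring mat Mat3_ring mat"
    by (rule alg_isoD(1)[OF alg_iso_comp[OF conj_s_iso conj_s_iso]])
  moreover have "id \<in> alg_hom Mat3_ring mat Mat3_ring mat"
    by (simp add: alg_hom_def ring_hom_def)
  ultimately have "(conj_s \<circ> conj_s) M = id M"
    by (rule Mat3_hom_eqI) (simp_all add: conj_s_gen)
  then show ?thesis by simp
qed

text \<open>The cube of \<open>conj_a \<circ> conj_s\<close> fixes both generators, because the
  composite permutes them and their q-commutator cyclically.\<close>

lemma conj_as_cubed: "conj_a (conj_s (conj_a (conj_s (conj_a (conj_s M))))) = M"
proof -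
  let ?t = "conj_a \<circ> conj_s"
  have t: "?t \<in> alg_iso Mat3_ring mat Mat3_ring mat"
    by (rule alg_iso_comp[OF conj_s_iso conj_a_iso])
  have "?t \<circ> (?t \<circ> ?t) \<in> alg_hom Mat3_ring mat Mat3_ring mat"
    by (rule alg_isoD(1)[OF alg_iso_comp[OF alg_iso_comp[OF t t] t]])
  moreover have "id \<in> alg_hom Mat3_ring mat Mat3_ring mat"
    by (simp add: alg_hom_def ring_hom_def)
  ultimately have "(?t \<circ> (?t \<circ> ?t)) M = id M"
    by (rule Mat3_hom_eqI)
      (simp_all add: conj_s_gen conj_a_gen qcomm_qcomm Mat3_hom_qcomm[OF conj_s_iso] Mat3_hom_qcomm[OF conj_a_iso])
  then show ?thesis by simp
qed

text \<open>Put b = sas. Since s is an involution and as has cube 1, asasa = s. Hence aba and bab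
  both equal s, whose square is 1. The values of b on the generators follow from those of a because
  s exchanges \<open>matX\<close> and \<open>matY\<close>.\<close>

lemma cherednik_action_Mat3:
  "cherednik_action Mat3_ring mat matX matY conj_a (conj_s \<circ> conj_a \<circ> conj_s)"
proof -
  have asasa: "conj_a (conj_s (conj_a (conj_s (conj_a M)))) = conj_s M" for M
    using conj_as_cubed[of "conj_s M"] by (simp add: conj_s_s)
  have "conj_s \<circ> conj_a \<circ> conj_s \<in> alg_iso Mat3_ring mat Mat3_ring mat"
    by (rule alg_iso_comp[OF conj_s_iso alg_iso_comp[OF conj_a_iso conj_s_iso], folded comp_assoc])
  then show ?thesis
    by (simp add: cherednik_action_def conj_a_iso asasa conj_s_s conj_s_gen conj_a_gen
        Mat3_hom_qcomm[OF conj_s_iso])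
qed

section \<open>The free algebra\<close>

lemma ring_F: "ring F_ring"
proof (rule ringI)
  show "abelian_group F_ring"
  proof (rule abelian_groupI)
    show "\<exists>y\<in>carrier F_ring. y \<oplus>\<^bsub>F_ring\<^esub> x = \<zero>\<^bsub>F_ring\<^esub>" for x
      by (auto simp: F_ring_def intro: left_minus)
  qed (auto simp: F_ring_def)
  show "Group.monoid F_ring"
    by (rule monoidI) (auto simp: F_ring_def mult.assoc)
qed (auto simp: F_ring_def distrib_left distrib_right)

lemma F_simps [simp]:
  "carrier F_ring = UNIV" "x \<otimes>\<^bsub>F_ring\<^esub> y = x * y" "\<one>\<^bsub>F_ring\<^esub> = 1"
  "\<zero>\<^bsub>F_ring\<^esub> = 0" "x \<oplus>\<^bsub>F_ring\<^esub> y = x + y"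
  by (simp_all add: F_ring_def)

lemma F_minus [simp]: "\<ominus>\<^bsub>F_ring\<^esub> x = - x" "x \<ominus>\<^bsub>F_ring\<^esub> y = x - y"
proof -
  interpret ring F_ring by (rule ring_F)
  show *: "\<ominus>\<^bsub>F_ring\<^esub> x = - x" for x
    by (rule minus_equality) auto
  show "x \<ominus>\<^bsub>F_ring\<^esub> y = x - y"
    by (simp add: a_minus_def *)
qed

lemma F_const_simps:
  "F_const (c + d) = F_const c + F_const d" "F_const (c * d) = F_const c * F_const d"
  "F_const 0 = 0" "F_const 1 = 1" "F_const (- c) = - F_const c"
  using mult_single[of "[] :: gen list" c "[]" d] single_one[where ?'a = "gen list"]
  by (simp_all add: F_const_def single_add plus_list_def zero_list_def single_uminus)

lemma F_single_Nil: "Poly_Mapping.single [] c = F_const c"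
  by (simp add: F_const_def)

lemma F_single_Cons: "Poly_Mapping.single ((X, g) # w) c = Og X g * Poly_Mapping.single w c"
  by (simp add: Og_def mult_single plus_list_def)

lemma update_eq_add_single:
  assumes "a \<notin> Poly_Mapping.keys f"
  shows "Poly_Mapping.update a b f = f + Poly_Mapping.single a b"
  using assms by (intro poly_mapping_eqI)
    (auto simp: lookup_update lookup_add lookup_single when_def in_keys_iff)

lemma F_const_commute: "F_const c * x = x * F_const c"
proof (induction x rule: update_induct)
  case (update f a b)
  have "Poly_Mapping.update a b f = f + Poly_Mapping.single a b"
    using update(1) by (rule update_eq_add_single)
  moreover have "F_const c * Poly_Mapping.single a b = Poly_Mapping.single a b * F_const c"
    by (simp add: F_const_def mult_single plus_list_def mult.commute)
  ultimately show ?case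
    using update by (simp add: distrib_left distrib_right)
qed simp

text \<open>Every element is a sum of words with coefficients, and a word grows by one letter on the
  left. The \<open>gen\<close> case therefore multiplies by a single generator.\<close>

lemma F_induct [case_names const gen add]:
  assumes "\<And>c. P (F_const c)" "\<And>X g x. P x \<Longrightarrow> P (Og X g * x)"
    and "\<And>x y. P x \<Longrightarrow> P y \<Longrightarrow> P (x + y)"
  shows "P x"
proof (induction x rule: update_induct)
  case const
  show ?case
    using assms(1)[of 0] by (simp add: F_const_simps)
next
  case (update f a b)
  have "Poly_Mapping.update a b f = f + Poly_Mapping.single a b"
    using update(1) by (rule update_eq_add_single)
  moreover have "P (Poly_Mapping.single a b)"
    by (induction a) (auto simp: F_single_Nil F_single_Cons assms)
  ultimately show ?case
    using update assms(3) by simp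
qed

lemma F_hom_eqI:
  assumes "h \<in> ring_hom F_ring R" "h' \<in> ring_hom F_ring R"
    and "\<And>c. h (F_const c) = h' (F_const c)" "\<And>X g. h (Og X g) = h' (Og X g)"
  shows "h x = h' x"
proof (induction x rule: F_induct)
  case (const c)
  show ?case by (rule assms(3))
next
  case (gen X g x)
  show ?case
    using ring_hom_mult[OF assms(1), of "Og X g" x] ring_hom_mult[OF assms(2), of "Og X g" x]
    unfolding F_simps by (simp only: gen assms(4) UNIV_I simp_thms)
next
  case (add x y)
  show ?case
    using ring_hom_add[OF assms(1), of x y] ring_hom_add[OF assms(2), of x y]
    unfolding F_simps by (simp only: add UNIV_I simp_thms)
qed

section \<open>Evaluation of the free algebra at the two matrices, with superscripts ignored\<close>

definition word_eval :: "gen list \<Rightarrow> kfield ^ 3 ^ 3" where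
  "word_eval w = foldr (\<lambda>z M. (case fst z of SideA \<Rightarrow> matX | SideB \<Rightarrow> matY) ** M) w (mat 1)"

lemma word_eval_append: "word_eval (v @ w) = word_eval v ** word_eval w"
  by (induction v) (auto simp: word_eval_def matrix_mul_assoc)

definition F_eval :: "falg \<Rightarrow> kfield ^ 3 ^ 3" where
  "F_eval x = (\<Sum>w \<in> Poly_Mapping.keys x. mat (Poly_Mapping.lookup x w) ** word_eval w)"

text \<open>Puts the two summands of a sum over one index set, and treats a monomial with zero
  coefficient like any other.\<close>

lemma F_eval_superset:
  assumes "finite W" "Poly_Mapping.keys x \<subseteq> W"
  shows "F_eval x = (\<Sum>w \<in> W. mat (Poly_Mapping.lookup x w) ** word_eval w)"
  unfolding F_eval_def using assms
  by (intro sum.mono_neutral_left) (auto simp: in_keys_iff)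

lemma F_eval_add: "F_eval (x + y) = F_eval x + F_eval y"
  using keys_add[of x y]
  by (simp add: F_eval_superset[of "Poly_Mapping.keys x \<union> Poly_Mapping.keys y"] lookup_add sum.distrib
      matrix_add_rdistrib flip: mat_add)

lemma F_eval_single: "F_eval (Poly_Mapping.single w c) = mat c ** word_eval w"
  by (simp add: F_eval_superset[of "{w}"])

lemma F_eval_gen: "F_eval (Og X g) = (case X of SideA \<Rightarrow> matX | SideB \<Rightarrow> matY)"
  by (simp add: Og_def F_eval_single word_eval_def)

lemma F_eval_const: "F_eval (F_const c) = mat c"
  by (simp add: F_const_def F_eval_single word_eval_def)

lemma F_eval_mult_single:
  "F_eval (Poly_Mapping.single v c * y) = mat c ** word_eval v ** F_eval y"
proof (induction y rule: update_induct)
  case const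
  then show ?case by (simp add: F_eval_def)
next
  case (update f a b)
  have "Poly_Mapping.update a b f = f + Poly_Mapping.single a b"
    using update(1) by (rule update_eq_add_single)
  moreover have "mat (c * b) ** (word_eval v ** word_eval a) = mat c ** word_eval v ** (mat b ** word_eval a)"
  proof -
    have "mat (c * b) ** (word_eval v ** word_eval a) = mat c ** (mat b ** word_eval v) ** word_eval a"
      by (simp add: matrix_mul_assoc mat_mult)
    then show ?thesis
      by (simp only: mat_commute[of b "word_eval v"] matrix_mul_assoc)
  qed
  ultimately show ?case
    using update
    by (simp add: distrib_left F_eval_add mult_single F_eval_single word_eval_append plus_list_def
        matrix_add_ldistrib)
qed

lemma F_eval_mult: "F_eval (x * y) = F_eval x ** F_eval y"
proof (induction x rule: F_induct)
  case (const c)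
  then show ?case by (simp add: F_const_def F_eval_mult_single F_eval_single)
next
  case (gen X g x)
  then show ?case by (simp add: Og_def F_eval_mult_single mult.assoc flip: matrix_mul_assoc)
next
  case (add x y)
  then show ?case by (simp add: distrib_right F_eval_add matrix_add_rdistrib)
qed

lemma F_eval_hom: "F_eval \<in> ring_hom F_ring Mat3_ring"
  using F_eval_const[of 1]
  by (intro ring_hom_memI) (auto simp: F_eval_add F_eval_mult F_const_simps)

lemma F_eval_minus: "F_eval (x - y) = F_eval x - F_eval y"
  using ring_hom_minus(2)[OF F_eval_hom ring_F ring_Mat3, of x y] by simp

lemma F_eval_relators: "r \<in> relators \<Longrightarrow> F_eval r = 0"
  by (induction rule: relators.induct)
    (auto simp: F_eval_add F_eval_mult F_eval_minus F_eval_gen F_eval_const matX_matY_relations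
      split: side.splits)

section \<open>The Casimir quotient\<close>

text \<open>The universal property of the quotient by a generated ideal. The homomorphism is
  constant on each coset, so the image of a coset is a singleton, and its only element is taken as
  the value.\<close>

lemma quotient_ring_hom_factor:
  assumes R: "ring R" and S: "ring S" and h: "h \<in> ring_hom R S"
    and H: "H \<subseteq> carrier R" "\<And>x. x \<in> H \<Longrightarrow> h x = \<zero>\<^bsub>S\<^esub>"
  shows "\<exists>h' \<in> ring_hom (R Quot Idl\<^bsub>R\<^esub> H) S. \<forall>x \<in> carrier R. h' (Idl\<^bsub>R\<^esub> H +>\<^bsub>R\<^esub> x) = h x"
proof -
  interpret h: ring_hom_ring R S h
    by (rule ring_hom_ringI2[OF R S h])
  have "ideal (Idl\<^bsub>R\<^esub> H) R"
    by (rule h.R.genideal_ideal[OF H(1)])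
  then interpret I: ideal "Idl\<^bsub>R\<^esub> H" R .
  let ?I = "Idl\<^bsub>R\<^esub> H" and ?h = "\<lambda>C. the_elem (h ` C)"
  \<comment> \<open>The kernel is an ideal containing the generators, hence it contains the ideal
    they generate.\<close>
  have "H \<subseteq> a_kernel R S h"
    unfolding a_kernel_def' using H by blast
  then have "?I \<subseteq> a_kernel R S h"
    by (rule h.R.genideal_minimal[OF h.kernel_is_ideal])
  then have I0: "h i = \<zero>\<^bsub>S\<^esub>" if "i \<in> ?I" for i
    using that unfolding a_kernel_def' by blast
  have val: "?h (?I +>\<^bsub>R\<^esub> x) = h x" if x: "x \<in> carrier R" for x
  proof -
    have "h ` (?I +>\<^bsub>R\<^esub> x) = {h x}"
    proof (intro equalityI subsetI)
      fix y assume "y \<in> h ` (?I +>\<^bsub>R\<^esub> x)"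
      then obtain i where i: "i \<in> ?I" "y = h (i \<oplus>\<^bsub>R\<^esub> x)"
        unfolding a_r_coset_def' by blast
      show "y \<in> {h x}"
        unfolding i(2) ring_hom_add[OF h I.Icarr[OF i(1)] x] I0[OF i(1)]
        using h.S.l_zero[OF ring_hom_closed[OF h x]] by blast
    next
      fix y assume "y \<in> {h x}"
      then show "y \<in> h ` (?I +>\<^bsub>R\<^esub> x)"
        using imageI[OF I.a_rcos_self[OF x], of h] by blast
    qed
    then show ?thesis by (simp only: the_elem_eq)
  qed
  note proj = I.rcos_ring_hom
  have surj: "\<exists>x \<in> carrier R. C = ?I +>\<^bsub>R\<^esub> x" if "C \<in> carrier (R Quot ?I)" for C
    using that unfolding FactRing_def A_RCOSETS_def' partial_object.select_convs by blast
  have "?h \<in> ring_hom (R Quot ?I) S"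
  proof (rule ring_hom_memI)
    fix C assume "C \<in> carrier (R Quot ?I)"
    then obtain x where x: "x \<in> carrier R" "C = ?I +>\<^bsub>R\<^esub> x"
      using surj by blast
    show "?h C \<in> carrier S"
      unfolding x(2) val[OF x(1)] by (rule ring_hom_closed[OF h x(1)])
  next
    fix C D assume CD: "C \<in> carrier (R Quot ?I)" "D \<in> carrier (R Quot ?I)"
    obtain x y where x: "x \<in> carrier R" "C = ?I +>\<^bsub>R\<^esub> x" and y: "y \<in> carrier R" "D = ?I +>\<^bsub>R\<^esub> y"
      using surj[OF CD(1)] surj[OF CD(2)] by blast
    have "?h (C \<otimes>\<^bsub>R Quot ?I\<^esub> D) = ?h (?I +>\<^bsub>R\<^esub> (x \<otimes>\<^bsub>R\<^esub> y))"
      unfolding x(2) y(2) ring_hom_mult[OF proj x(1) y(1)] ..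
    also have "\<dots> = h x \<otimes>\<^bsub>S\<^esub> h y"
      using val[OF h.R.m_closed[OF x(1) y(1)]] ring_hom_mult[OF h x(1) y(1)] by (rule trans)
    finally show "?h (C \<otimes>\<^bsub>R Quot ?I\<^esub> D) = ?h C \<otimes>\<^bsub>S\<^esub> ?h D"
      unfolding x(2) y(2) val[OF x(1)] val[OF y(1)] .
    have "?h (C \<oplus>\<^bsub>R Quot ?I\<^esub> D) = ?h (?I +>\<^bsub>R\<^esub> (x \<oplus>\<^bsub>R\<^esub> y))"
      unfolding x(2) y(2) ring_hom_add[OF proj x(1) y(1)] ..
    also have "\<dots> = h x \<oplus>\<^bsub>S\<^esub> h y"
      using val[OF h.R.a_closed[OF x(1) y(1)]] ring_hom_add[OF h x(1) y(1)] by (rule trans)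
    finally show "?h (C \<oplus>\<^bsub>R Quot ?I\<^esub> D) = ?h C \<oplus>\<^bsub>S\<^esub> ?h D"
      unfolding x(2) y(2) val[OF x(1)] val[OF y(1)] .
  next
    have "?h \<one>\<^bsub>R Quot ?I\<^esub> = ?h (?I +>\<^bsub>R\<^esub> \<one>\<^bsub>R\<^esub>)"
      unfolding ring_hom_one[OF proj] ..
    also have "\<dots> = \<one>\<^bsub>S\<^esub>"
      using val[OF h.R.one_closed] ring_hom_one[OF h] by (rule trans)
    finally show "?h \<one>\<^bsub>R Quot ?I\<^esub> = \<one>\<^bsub>S\<^esub>" .
  qed
  then show ?thesis
    using val by (intro bexI[of _ ?h] ballI)
qed

lemma I_ideal: "ideal I_ideal F_ring"
  unfolding I_ideal_def by (rule ring.genideal_ideal[OF ring_F]) simp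

lemma ring_A: "ring A_ring"
  unfolding A_ring_def by (rule ideal.quotient_is_ring[OF I_ideal])

lemma A_proj_hom: "A_proj \<in> ring_hom F_ring A_ring"
  using ideal.rcos_ring_hom[OF I_ideal] by (simp add: A_ring_def A_proj_def[abs_def])

lemma A_proj_closed [simp]: "A_proj x \<in> carrier A_ring"
  using ring_hom_closed[OF A_proj_hom] by simp

lemma A_proj_surj: "z \<in> carrier A_ring \<Longrightarrow> \<exists>x. z = A_proj x"
 unfolding A_ring_def A_proj_def FactRing_def A_RCOSETS_def' partial_object.select_convs by blast

lemma J_gens: "{casimir} \<union> {A_gen X g \<ominus>\<^bsub>A_ring\<^esub> A_gen X 1 | X g. True} \<subseteq> carrier A_ring"
  using ring.ring_simprules(4)[OF ring_A] by (auto simp: casimir_def A_gen_def)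

lemma J_ideal: "ideal J_ideal A_ring"
  unfolding J_ideal_def by (rule ring.genideal_ideal[OF ring_A J_gens])

lemma ring_A0: "ring A0_ring"
  unfolding A0_ring_def by (rule ideal.quotient_is_ring[OF J_ideal])

lemma A0_proj_hom: "A0_proj \<in> ring_hom A_ring A0_ring"
  using ideal.rcos_ring_hom[OF J_ideal] by (simp add: A0_ring_def A0_proj_def[abs_def])

text \<open>The composite of both quotient maps. It allows computations in the Casimir quotient to
  be carried out with representatives in the free algebra.\<close>

definition proj :: "falg \<Rightarrow> falg set set" where
  "proj x = A0_proj (A_proj x)"

lemma proj_hom: "proj \<in> ring_hom F_ring A0_ring"
  using ring_hom_trans[OF A_proj_hom A0_proj_hom] by (simp add: proj_def[abs_def] comp_def)

lemma proj_closed [simp]: "proj x \<in> carrier A0_ring"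
  using ring_hom_closed[OF proj_hom] by simp

lemma proj_surj: "z \<in> carrier A0_ring \<Longrightarrow> \<exists>x. z = proj x"
  using A_proj_surj
  unfolding A0_ring_def A0_proj_def proj_def FactRing_def A_RCOSETS_def' partial_object.select_convs by blast

lemma proj_add: "proj (x + y) = proj x \<oplus>\<^bsub>A0_ring\<^esub> proj y"
  using ring_hom_add[OF proj_hom, of x y] by simp

lemma proj_mult: "proj (x * y) = proj x \<otimes>\<^bsub>A0_ring\<^esub> proj y"
  using ring_hom_mult[OF proj_hom, of x y] by simp

lemma proj_0: "proj 0 = \<zero>\<^bsub>A0_ring\<^esub>"
  using ring_hom_zero[OF proj_hom ring_F ring_A0] by simp

lemma proj_minus: "proj (x - y) = proj x \<ominus>\<^bsub>A0_ring\<^esub> proj y"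
  using ring_hom_minus(2)[OF proj_hom ring_F ring_A0, of x y] by simp

lemma proj_eq_iff: "proj x = proj y \<longleftrightarrow> proj (x - y) = proj 0"
proof -
  interpret ring A0_ring by (rule ring_A0)
  show ?thesis
    by (metis proj_0 proj_closed proj_minus r_right_minus_eq)
qed

lemma proj_relators: "r \<in> relators \<Longrightarrow> proj r = proj 0"
proof -
  assume "r \<in> relators"
  then have "r \<in> I_ideal"
    using ring.genideal_self[OF ring_F, of relators] by (auto simp: I_ideal_def)
  then have "A_proj r = \<zero>\<^bsub>A_ring\<^esub>"
    using ideal.Icarr[OF I_ideal] ring.a_rcos_zero[OF ring_F I_ideal]
    by (simp add: A_proj_def A_ring_def FactRing_def)
  then show ?thesis
    using ring_hom_zero[OF A_proj_hom ring_F ring_A] by (simp add: proj_def)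
qed

lemma J_zero: "z \<in> J_ideal \<Longrightarrow> A0_proj z = \<zero>\<^bsub>A0_ring\<^esub>"
  using ring.a_rcos_zero[OF ring_A J_ideal] by (simp add: A0_proj_def A0_ring_def FactRing_def)

lemma proj_gen: "proj (Og X g) = proj (Og X 1)"
proof -
  have "A_proj (Og X g - Og X 1) = A_gen X g \<ominus>\<^bsub>A_ring\<^esub> A_gen X 1"
    using ring_hom_minus(2)[OF A_proj_hom ring_F ring_A, of "Og X g" "Og X 1"]
    by (simp add: A_gen_def)
  also have "\<dots> \<in> J_ideal"
    using ring.genideal_self[OF ring_A J_gens] by (auto simp: J_ideal_def)
  finally show ?thesis
    by (metis J_zero proj_0 proj_def proj_eq_iff)
qed

lemma proj_casimir:
  "proj (F_const (1 / dq ^ 4) * (OB 1 * OB 1 * OA 1 * OA 1)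
     + F_const (1 / dq ^ 2) * (OA 1 * OA 1 + OB 1 * OB 1) + 1) = proj 0"
proof -
  have "casimir \<in> J_ideal"
    using ring.genideal_self[OF ring_A J_gens] by (auto simp: J_ideal_def)
  then show ?thesis
    using J_zero[of casimir] unfolding casimir_def proj_0 by (simp only: proj_def)
qed

lemma F_eval_casimir:
  "F_eval (F_const (1 / dq ^ 4) * (OB 1 * OB 1 * OA 1 * OA 1)
     + F_const (1 / dq ^ 2) * (OA 1 * OA 1 + OB 1 * OB 1) + 1) = 0"
  using matX_matY_relations(9) F_eval_const[of 1]
  by (simp add: F_eval_add F_eval_mult F_eval_gen F_eval_const F_const_simps)

text \<open>The universal property is applied twice: first to the relators, then to the Casimir
  element and the differences of generators, on which the evaluation vanishes as well.\<close>

lemma ex_A0_eval: "\<exists>h \<in> ring_hom A0_ring Mat3_ring. \<forall>x. h (proj x) = F_eval x"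
proof -
  obtain h where h: "h \<in> ring_hom A_ring Mat3_ring" "\<And>x. h (A_proj x) = F_eval x"
    using quotient_ring_hom_factor[OF ring_F ring_Mat3 F_eval_hom, of relators] F_eval_relators
    by (auto simp: A_ring_def I_ideal_def A_proj_def)
  have "h z = \<zero>\<^bsub>Mat3_ring\<^esub>"
    if "z \<in> {casimir} \<union> {A_gen X g \<ominus>\<^bsub>A_ring\<^esub> A_gen X 1 | X g. True}" for z
  proof -
    have "h (A_gen X g \<ominus>\<^bsub>A_ring\<^esub> A_gen X 1) = 0" for X g
      using ring_hom_minus(2)[OF h(1) ring_A ring_Mat3, of "A_gen X g" "A_gen X 1"]
      by (simp add: A_gen_def h(2) F_eval_gen)
    moreover have "h casimir = 0"
      by (simp add: casimir_def h(2) F_eval_casimir)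
    ultimately show ?thesis
      using that by auto
  qed
  from quotient_ring_hom_factor[OF ring_A ring_Mat3 h(1) J_gens this]
  obtain h' where "h' \<in> ring_hom A0_ring Mat3_ring" "\<forall>z \<in> carrier A_ring. h' (A0_proj z) = h z"
    by (auto simp: A0_ring_def J_ideal_def A0_proj_def)
  then show ?thesis
    by (intro bexI[of _ h']) (simp_all add: proj_def h(2))
qed

section \<open>Nine words that span the Casimir quotient\<close>

definition nf_words :: "falg list" where
  "nf_words = [1, OA 1, OB 1, OA 1 * OA 1, OB 1 * OB 1, OA 1 * OB 1, OB 1 * OA 1,
     OA 1 * OA 1 * OB 1, OB 1 * OB 1 * OA 1]"

definition nf :: "(nat \<Rightarrow> kfield) \<Rightarrow> falg" where
  "nf c = (\<Sum>i<9. F_const (c i) * nf_words ! i)"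

definition spanned :: "falg \<Rightarrow> bool" where
  "spanned x \<longleftrightarrow> (\<exists>c. proj x = proj (nf c))"

lemma spanned_cong: "proj x = proj y \<Longrightarrow> spanned x \<longleftrightarrow> spanned y"
  by (simp add: spanned_def)

lemma spanned_add: "spanned x \<Longrightarrow> spanned y \<Longrightarrow> spanned (x + y)"
proof -
  have "nf c + nf d = nf (\<lambda>i. c i + d i)" for c d
    by (simp add: nf_def F_const_simps distrib_right sum.distrib)
  then show "spanned x \<Longrightarrow> spanned y \<Longrightarrow> spanned (x + y)"
    unfolding spanned_def proj_add by (metis proj_add)
qed

lemma spanned_scale: "spanned x \<Longrightarrow> spanned (F_const c * x)"
proof -
  have "F_const c * nf d = nf (\<lambda>i. c * d i)" for d
    by (simp add: nf_def F_const_simps sum_distrib_left mult.assoc)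
  then show "spanned x \<Longrightarrow> spanned (F_const c * x)"
    unfolding spanned_def proj_mult by (metis proj_mult)
qed

lemma spanned_0: "spanned 0"
  unfolding spanned_def by (rule exI[of _ "\<lambda>_. 0"]) (simp add: nf_def F_const_simps)

lemma spanned_diff: "spanned x \<Longrightarrow> spanned y \<Longrightarrow> spanned (x - y)"
  using spanned_add[OF _ spanned_scale[of y "- 1"], of x] by (simp add: F_const_simps)

lemma spanned_sum: "(\<And>i. i \<in> I \<Longrightarrow> spanned (f i)) \<Longrightarrow> spanned (sum f I)"
  by (induction I rule: infinite_finite_induct) (auto intro: spanned_add spanned_0)

lemma spanned_word:
  assumes "i < 9" shows "spanned (nf_words ! i)"
proof -
  have "(\<Sum>j<9. F_const (if j = i then 1 else 0) * nf_words ! j) = nf_words ! i"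
    using assms by (simp add: F_const_simps if_distrib[of F_const] if_distrib[of "\<lambda>x. x * _"] cong: if_cong)
  then show ?thesis
    unfolding spanned_def nf_def by (intro exI[of _ "\<lambda>j. if j = i then 1 else 0"]) simp
qed

lemma less_9_cases:
  "(i :: nat) < 9 \<Longrightarrow> i = 0 \<or> i = 1 \<or> i = 2 \<or> i = 3 \<or> i = 4 \<or> i = 5 \<or> i = 6 \<or> i = 7 \<or> i = 8"
  by auto

lemma spanned_words:
  "spanned 1" "spanned (OA 1)" "spanned (OB 1)" "spanned (OA 1 * OA 1)" "spanned (OB 1 * OB 1)"
  "spanned (OA 1 * OB 1)" "spanned (OB 1 * OA 1)" "spanned (OA 1 * OA 1 * OB 1)"
  "spanned (OB 1 * OB 1 * OA 1)"
  using spanned_word[of 0] spanned_word[of 1] spanned_word[of 2] spanned_word[of 3] spanned_word[of 4]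
    spanned_word[of 5] spanned_word[of 6] spanned_word[of 7] spanned_word[of 8]
  by (simp_all add: nf_words_def)

definition null :: "falg \<Rightarrow> bool" where
  "null x \<longleftrightarrow> proj x = proj 0"

lemma null_mult:
  assumes "null x" shows "null (y * x)" "null (x * y)"
proof -
  have "proj (y * x) = proj (y * 0)" "proj (x * y) = proj (0 * y)"
    using assms unfolding null_def proj_mult by simp_all
  then show "null (y * x)" "null (x * y)"
    by (simp_all add: null_def)
qed

lemma null_spanned: "null x \<Longrightarrow> spanned x"
  using spanned_cong[of x 0] spanned_0 by (simp add: null_def)

text \<open>Turns a relation into a rewriting rule: the first summand is congruent to the negative
  of the second, which lies in the span.\<close>

lemma spanned_cancel:
  assumes "null (x + y)" "spanned y" shows "spanned x"
  using spanned_diff[OF null_spanned[OF assms(1)] assms(2)] by simp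

text \<open>The products that leave the list are reduced one by one: cubes by the cubic relations,
  \<open>ABA\<close> and \<open>BAB\<close> to zero, \<open>BAA\<close> and \<open>ABB\<close> by
  the mixed relations. The remaining words \<open>ABBA\<close> and \<open>BAAB\<close> lead to
  \<open>BBAA\<close>, which the Casimir relation eliminates.\<close>

lemma spanned_mult_word:
  assumes "i < 9" shows "spanned (Og X 1 * nf_words ! i)"
proof -
  note rel = relators.intros[THEN proj_relators, folded null_def]
  have AAA: "null (OA 1 * OA 1 * OA 1 + F_const (dq ^ 2) * OA 1)"
    and BBB: "null (OB 1 * OB 1 * OB 1 + F_const (dq ^ 2) * OB 1)"
    by (rule rel)+
  have ABA: "null (OA 1 * OB 1 * OA 1)" and BAB: "null (OB 1 * OA 1 * OB 1)"
    by (rule rel)+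
  have AAB: "null (OA 1 * OA 1 * OB 1 + F_const (dq ^ 2) * OB 1 + OB 1 * OA 1 * OA 1)"
    and BBA: "null (OB 1 * OB 1 * OA 1 + F_const (dq ^ 2) * OA 1 + OA 1 * OB 1 * OB 1)"
    by (rule rel)+
  \<comment> \<open>Multiplying the Casimir relation by \<open>dq ^ 4\<close> makes the coefficient
    of this word equal to 1.\<close>
  have BBAA: "spanned (OB 1 * OB 1 * OA 1 * OA 1)"
  proof -
    have "null (F_const (dq ^ 4) * (F_const (1 / dq ^ 4) * (OB 1 * OB 1 * OA 1 * OA 1)
     + F_const (1 / dq ^ 2) * (OA 1 * OA 1 + OB 1 * OB 1) + 1))"
      using null_mult proj_casimir by (simp add: null_def)
    also have "F_const (dq ^ 4) * (F_const (1 / dq ^ 4) * (OB 1 * OB 1 * OA 1 * OA 1)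
     + F_const (1 / dq ^ 2) * (OA 1 * OA 1 + OB 1 * OB 1) + 1) =
      F_const (dq ^ 4 * (1 / dq ^ 4)) * (OB 1 * OB 1 * OA 1 * OA 1)
      + (F_const (dq ^ 4 * (1 / dq ^ 2)) * (OA 1 * OA 1 + OB 1 * OB 1) + F_const (dq ^ 4) * 1)"
      unfolding F_const_simps by (simp add: distrib_left mult.assoc)
    also have "F_const (dq ^ 4 * (1 / dq ^ 4)) = 1"
      by (simp add: dq_nz F_const_simps)
    finally show ?thesis
      unfolding mult_1_left by (rule spanned_cancel) (intro spanned_add spanned_scale spanned_words)
  qed
  have BAA: "spanned (OB 1 * OA 1 * OA 1)"
  proof (rule spanned_cancel)
    show "null (OB 1 * OA 1 * OA 1 + (OA 1 * OA 1 * OB 1 + F_const (dq ^ 2) * OB 1))"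
      using AAB by (simp add: add_ac)
  qed (intro spanned_add spanned_scale spanned_words)
  have ABB: "spanned (OA 1 * OB 1 * OB 1)"
  proof (rule spanned_cancel)
    show "null (OA 1 * OB 1 * OB 1 + (OB 1 * OB 1 * OA 1 + F_const (dq ^ 2) * OA 1))"
      using BBA by (simp add: add_ac)
  qed (intro spanned_add spanned_scale spanned_words)
  have AAAB: "spanned (OA 1 * (OA 1 * OA 1 * OB 1))"
  proof (rule spanned_cancel)
    show "null (OA 1 * (OA 1 * OA 1 * OB 1) + F_const (dq ^ 2) * (OA 1 * OB 1))"
      using null_mult(2)[OF AAA, of "OB 1"] by (simp add: algebra_simps)
  qed (intro spanned_scale spanned_words)
  have BBBA: "spanned (OB 1 * (OB 1 * OB 1 * OA 1))"
  proof (rule spanned_cancel)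
    show "null (OB 1 * (OB 1 * OB 1 * OA 1) + F_const (dq ^ 2) * (OB 1 * OA 1))"
      using null_mult(2)[OF BBB, of "OA 1"] by (simp add: algebra_simps)
  qed (intro spanned_scale spanned_words)
  \<comment> \<open>The mixed relation, multiplied by \<open>OA 1\<close> on the right, trades this
    word for \<open>BBAA\<close>.\<close>
  have ABBA: "spanned (OA 1 * (OB 1 * OB 1 * OA 1))"
  proof (rule spanned_cancel)
    show "null (OA 1 * (OB 1 * OB 1 * OA 1) + (OB 1 * OB 1 * OA 1 * OA 1 + F_const (dq ^ 2) * (OA 1 * OA 1)))"
      using null_mult(2)[OF BBA, of "OA 1"] by (simp add: algebra_simps)
  qed (intro spanned_add spanned_scale spanned_words BBAA)
  \<comment> \<open>The same relation multiplied by \<open>OA 1\<close> on the left leads back to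
    \<open>ABBA\<close>; the scalar has to be moved to the front.\<close>
  have AABB: "spanned (OA 1 * OA 1 * OB 1 * OB 1)"
  proof -
    have "null (OA 1 * (OB 1 * OB 1 * OA 1 + F_const (dq ^ 2) * OA 1 + OA 1 * OB 1 * OB 1))"
      by (rule null_mult(1)[OF BBA])
    also have "OA 1 * (OB 1 * OB 1 * OA 1 + F_const (dq ^ 2) * OA 1 + OA 1 * OB 1 * OB 1) =
      OA 1 * OA 1 * OB 1 * OB 1 + (OA 1 * (OB 1 * OB 1 * OA 1) + OA 1 * F_const (dq ^ 2) * OA 1)"
      by (simp add: algebra_simps)
    also have "OA 1 * F_const (dq ^ 2) * OA 1 = F_const (dq ^ 2) * (OA 1 * OA 1)"
      by (simp only: F_const_commute[of _ "OA 1", symmetric] mult.assoc)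
    finally show ?thesis
      by (rule spanned_cancel) (intro spanned_add ABBA spanned_scale spanned_words)
  qed
  have BAAB: "spanned (OB 1 * (OA 1 * OA 1 * OB 1))"
  proof (rule spanned_cancel)
    show "null (OB 1 * (OA 1 * OA 1 * OB 1) + (OA 1 * OA 1 * OB 1 * OB 1 + F_const (dq ^ 2) * (OB 1 * OB 1)))"
      using null_mult(2)[OF AAB, of "OB 1"] by (simp add: algebra_simps)
  qed (intro spanned_add spanned_scale spanned_words AABB)
  have AAA': "spanned (OA 1 * OA 1 * OA 1)"
    by (rule spanned_cancel[OF AAA]) (intro spanned_scale spanned_words)
  have BBB': "spanned (OB 1 * OB 1 * OB 1)"
    by (rule spanned_cancel[OF BBB]) (intro spanned_scale spanned_words)
  show ?thesis
    using less_9_cases[OF assms] BAA ABB AAAB BBBA ABBA BAAB AAA' BBB' ABA[THEN null_spanned] BAB[THEN null_spanned]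
      spanned_words
    by (cases X) (elim disjE; simp add: nf_words_def mult.assoc)+
qed

text \<open>The span contains the scalars and is closed under sums and under left multiplication by
  generators, since in the quotient a generator equals the one with superscript 1.\<close>

lemma spanned_all: "spanned x"
proof (induction x rule: F_induct)
  case (const c)
  then show ?case
    using spanned_scale[OF spanned_words(1), of c] by simp
next
  case (gen X g x)
  then obtain c where c: "proj x = proj (nf c)"
    by (auto simp: spanned_def)
  have "proj (Og X g * x) = proj (Og X 1 * nf c)"
    unfolding proj_mult c proj_gen[of X g] ..
  also have "Og X 1 * nf c = (\<Sum>i<9. F_const (c i) * (Og X 1 * nf_words ! i))"
    unfolding nf_def sum_distrib_left
    by (simp only: F_const_commute[of _ "Og X 1", symmetric] mult.assoc[symmetric])
  finally have "proj (Og X g * x) = proj (\<Sum>i<9. F_const (c i) * (Og X 1 * nf_words ! i))" .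
  moreover have "spanned (\<Sum>i<9. F_const (c i) * (Og X 1 * nf_words ! i))"
    by (intro spanned_sum spanned_scale spanned_mult_word) simp
  ultimately show ?case
    by (rule spanned_cong[THEN iffD2])
qed (rule spanned_add)

lemma nf_expand:
  "nf c = F_const (c 0) + F_const (c 1) * OA 1 + F_const (c 2) * OB 1 + F_const (c 3) * (OA 1 * OA 1)
    + F_const (c 4) * (OB 1 * OB 1) + F_const (c 5) * (OA 1 * OB 1) + F_const (c 6) * (OB 1 * OA 1)
    + F_const (c 7) * (OA 1 * OA 1 * OB 1) + F_const (c 8) * (OB 1 * OB 1 * OA 1)"
  by (simp add: nf_def nf_words_def eval_nat_numeral add.assoc)

text \<open>Linear independence of the values of the nine words. Up to nonzero factors, reversing
  the order of the basis changes the sign of \<open>j\<close> in the nine entries, so sums and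
  differences of opposite entries separate the unknowns.\<close>

lemma F_eval_nf_eq_0:
  assumes "F_eval (nf c) = 0" shows "nf c = 0"
proof -
  define j where "j = cconst \<i> * dq"
  have "cconst \<i> \<noteq> 0"
    by (simp add: cconst_eq_0)
  then have j: "j \<noteq> 0" "dq ^ 2 = - (j ^ 2)"
    using dq_nz by (auto simp: j_def power_mult_distrib power2_eq_square[of "cconst \<i>"] cconst_ii_sq)
  define k where "k = - (1 / 2) * dq ^ 2"
  have k: "k \<noteq> 0"
    using dq_nz numeral_kfield_nz by (simp add: k_def)
  have XY: "matX = vector [vector [- j, 0, 0], vector [0, 0, 0], vector [0, 0, j]]"
    "matY = vector [vector [0, 1, 0], vector [k, 0, 1], vector [0, k, 0]]"
    by (simp_all add: matX_def matY_def j_def k_def)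
  have "F_eval (nf c) = mat (c 0) + mat (c 1) ** matX + mat (c 2) ** matY + mat (c 3) ** (matX ** matX)
    + mat (c 4) ** (matY ** matY) + mat (c 5) ** (matX ** matY) + mat (c 6) ** (matY ** matX)
    + mat (c 7) ** (matX ** matX ** matY) + mat (c 8) ** (matY ** matY ** matX)"
    by (simp add: nf_expand F_eval_add F_eval_mult F_eval_gen F_eval_const)
  also have "\<dots> = vector [
      vector [c 0 - j * c 1 + j ^ 2 * c 3 + k * c 4 - j * k * c 8, c 2 - j * c 5 + j ^ 2 * c 7, c 4 + j * c 8],
      vector [k * (c 2 - j * c 6), c 0 + 2 * k * c 4, c 2 + j * c 6],
      vector [k ^ 2 * (c 4 - j * c 8), k * (c 2 + j * c 5 + j ^ 2 * c 7), c 0 + j * c 1 + j ^ 2 * c 3 + k * c 4 + j * k * c 8]]"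
    (is "_ = ?V")
    unfolding XY mat_matrix_mult by (simp add: mat3_eval algebra_simps power2_eq_square)
  finally have "F_eval (nf c) = ?V" .
  note comp = this[unfolded assms vec_eq_iff forall_3 vector_3 zero_index]
  have eqs: "c 0 - j * c 1 + j ^ 2 * c 3 + k * c 4 - j * k * c 8 = 0"
    "c 0 + j * c 1 + j ^ 2 * c 3 + k * c 4 + j * k * c 8 = 0" "c 0 + 2 * k * c 4 = 0"
    "c 4 + j * c 8 = 0" "c 4 - j * c 8 = 0" "c 2 - j * c 6 = 0" "c 2 + j * c 6 = 0"
    "c 2 - j * c 5 + j ^ 2 * c 7 = 0" "c 2 + j * c 5 + j ^ 2 * c 7 = 0"
    using comp k unfolding eq_commute[of "0 :: kfield"] mult_eq_0_iff power_eq_0_iff by blast+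
  have pm: "x = 0 \<and> y = 0" if "x + j * y = 0" "x - j * y = 0" for x y
  proof -
    have "2 * x = (x + j * y) + (x - j * y)" by simp
    then show ?thesis
      using that j numeral_kfield_nz by simp
  qed
  \<comment> \<open>The corners give \<open>c 4\<close> and \<open>c 8\<close>, the middle row gives
    \<open>c 2\<close> and \<open>c 6\<close>; then the central entry gives \<open>c 0\<close>, and
    the remaining pairs become solvable.\<close>
  have 48: "c 4 = 0" "c 8 = 0" and 26: "c 2 = 0" "c 6 = 0"
    using pm[of "c 4" "c 8"] pm[of "c 2" "c 6"] eqs by simp_all
  then have 0: "c 0 = 0"
    using eqs by simp
  have 31: "c 3 = 0" "c 1 = 0"
    using pm[of "j ^ 2 * c 3" "c 1"] eqs 0 48 j by (simp_all add: algebra_simps)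
  have 75: "c 7 = 0" "c 5 = 0"
    using pm[of "j ^ 2 * c 7" "c 5"] eqs 26 j by (simp_all add: algebra_simps)
  show ?thesis
    using 0 48 26 31 75 by (simp add: nf_expand F_const_simps)
qed

section \<open>The Casimir quotient as a matrix algebra, and the transported modular action\<close>

definition A0_eval :: "falg set set \<Rightarrow> kfield ^ 3 ^ 3" where
  "A0_eval = (SOME h. h \<in> ring_hom A0_ring Mat3_ring \<and> (\<forall>x. h (proj x) = F_eval x))"

lemma A0_eval: "A0_eval \<in> ring_hom A0_ring Mat3_ring" "A0_eval (proj x) = F_eval x"
  using someI_ex[of "\<lambda>h. h \<in> ring_hom A0_ring Mat3_ring \<and> (\<forall>x. h (proj x) = F_eval x)"] ex_A0_eval
  unfolding A0_eval_def by blast+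

lemma proj_const: "proj (F_const c) = A0_const c"
  by (simp add: proj_def A0_const_def A_const_def)

lemma proj_Og: "proj (Og X g) = A0_gen X g"
  by (simp add: proj_def A0_gen_def A_gen_def)

text \<open>Surjective since the values include generators of the matrix algebra. Injective since a
  difference of representatives is congruent to a combination of the nine words, whose coefficients
  vanish if its value does.\<close>

lemma A0_eval_iso: "A0_eval \<in> alg_iso A0_ring A0_const Mat3_ring mat"
proof -
  have "\<exists>x. F_eval x = M" for M
  proof (induction M rule: matX_matY_induct)
    case (1 c)
    show ?case using F_eval_const by blast
  next
    case 2
    show ?case using F_eval_gen[of SideA] by auto
  next
    case 3
    show ?case using F_eval_gen[of SideB] by auto
  next
    case (4 M N)
    then show ?case using F_eval_add by metis
  next
    case (5 M N)
    then show ?case using F_eval_mult by metis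
  qed
  then have surj: "A0_eval ` carrier A0_ring = UNIV"
    by (metis A0_eval(2) proj_closed rangeI surj_def image_eqI UNIV_eq_I)
  have "inj_on A0_eval (carrier A0_ring)"
  proof (rule inj_onI)
    fix y z assume "y \<in> carrier A0_ring" "z \<in> carrier A0_ring" and eq: "A0_eval y = A0_eval z"
    then obtain u v where u: "y = proj u" and v: "z = proj v"
      using proj_surj by blast
    obtain c where c: "proj (u - v) = proj (nf c)"
      using spanned_all unfolding spanned_def by blast
    have "F_eval (nf c) = F_eval (u - v)"
      by (metis A0_eval(2) c)
    also have "\<dots> = 0"
      using eq by (simp add: u v A0_eval(2) F_eval_minus)
    finally show "y = z"
      using c F_eval_nf_eq_0 proj_eq_iff u v by metis
  qed
  then show ?thesis
    using surj A0_eval(1) A0_eval(2)[of "F_const _"]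
    by (auto simp: alg_iso_def alg_hom_def bij_betw_def proj_const F_eval_const)
qed

lemma A0_eval_gen: "A0_eval (A0_gen X g) = (case X of SideA \<Rightarrow> matX | SideB \<Rightarrow> matY)"
  by (metis A0_eval(2) F_eval_gen proj_Og)

text \<open>Transport of structure along \<open>A0_eval\<close>: the modular action on the quotient
  is obtained from conjugations of matrices.\<close>

definition A0_lift :: "(kfield ^ 3 ^ 3 \<Rightarrow> kfield ^ 3 ^ 3) \<Rightarrow> falg set set \<Rightarrow> falg set set" where
  "A0_lift f = inv_into (carrier A0_ring) A0_eval \<circ> f \<circ> A0_eval"

lemma A0_eval_lift: "A0_eval (A0_lift f x) = f (A0_eval x)"
  using alg_isoD(4)[OF A0_eval_iso] by (simp add: A0_lift_def bij_betw_inv_into_right)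

lemma A0_const_closed: "A0_const c \<in> carrier A0_ring"
  by (simp flip: proj_const)

lemma A0_gen_closed: "A0_gen X g \<in> carrier A0_ring"
  by (simp flip: proj_Og)

lemma A0_lift_iso:
  assumes "f \<in> alg_iso Mat3_ring mat Mat3_ring mat"
  shows "A0_lift f \<in> alg_iso A0_ring A0_const A0_ring A0_const"
  unfolding A0_lift_def
  by (intro alg_iso_comp[OF A0_eval_iso] alg_iso_comp[OF assms] alg_iso_inv[OF ring_A0 A0_eval_iso])
    (auto simp: A0_const_closed)

lemma A0_eqI:
  assumes "x \<in> carrier A0_ring" "y \<in> carrier A0_ring" "A0_eval x = A0_eval y"
  shows "x = y"
  using alg_isoD(4)[OF A0_eval_iso] assms by (auto simp: bij_betw_def inj_on_def)

lemma A0_lift_closed: "A0_lift f x \<in> carrier A0_ring"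
  using alg_isoD(4)[OF A0_eval_iso] by (simp add: A0_lift_def bij_betw_def inv_into_into)

text \<open>\<open>A0_eval\<close> is injective on the carrier and forgets superscripts, so each
  required equation becomes one about matrices and conjugations.\<close>

lemma modular_action_A0:
  "modular_action A0_ring A0_const A0_gen (A0_lift conj_a) (A0_lift conj_s)"
proof -
  interpret ring A0_ring by (rule ring_A0)
  note cl = A0_lift_closed A0_gen_closed A0_const_closed
  note hom = alg_isoD(2)[OF A0_eval_iso]
  have e: "A0_eval (A0_const c) = mat c" for c
    by (rule alg_isoD(3)[OF A0_eval_iso])
  have const: "range A0_const \<subseteq> carrier A0_ring"
    using cl(3) by blast
  \<comment> \<open>By its cubic relation, \<open>matX\<close> is the value of the sandwich of three
    factors in the formula for the first automorphism.\<close>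
  have cube: "mat (- (1 / dq ^ 2)) ** (matX ** matX ** matX) = matX"
    by (simp add: matX_def mat3_calc)
  have a_A: "A0_lift conj_a (A0_gen SideA g) =
      A0_const (- 1 / dq ^ 2) \<otimes>\<^bsub>A0_ring\<^esub> (A0_gen SideA 1 \<otimes>\<^bsub>A0_ring\<^esub> A0_gen SideA (g * inverse ga)
        \<otimes>\<^bsub>A0_ring\<^esub> A0_gen SideA 1)" for g
  proof (rule A0_eqI)
    show "A0_eval (A0_lift conj_a (A0_gen SideA g)) = A0_eval (A0_const (- 1 / dq ^ 2) \<otimes>\<^bsub>A0_ring\<^esub>
      (A0_gen SideA 1 \<otimes>\<^bsub>A0_ring\<^esub> A0_gen SideA (g * inverse ga) \<otimes>\<^bsub>A0_ring\<^esub> A0_gen SideA 1))"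
      unfolding ring_hom_mult[OF hom cl(3) m_closed[OF m_closed[OF cl(2,2)] cl(2)]]
        ring_hom_mult[OF hom m_closed[OF cl(2,2)] cl(2)] ring_hom_mult[OF hom cl(2,2)]
      by (simp add: A0_eval_lift A0_eval_gen conj_a_gen e cube)
  qed (intro m_closed cl)+
  have a_B: "A0_lift conj_a (A0_gen SideB g) =
      qcomm A0_ring A0_const (A0_gen SideA 1) (A0_gen SideB (g * inverse ga))" for g
  proof (rule A0_eqI)
    show "A0_eval (A0_lift conj_a (A0_gen SideB g)) =
      A0_eval (qcomm A0_ring A0_const (A0_gen SideA 1) (A0_gen SideB (g * inverse ga)))"
      using alg_hom_qcomm[OF alg_isoD(1)[OF A0_eval_iso] ring_A0 ring_Mat3 const cl(2,2)]
      by (simp add: A0_eval_lift A0_eval_gen conj_a_gen)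
    show "qcomm A0_ring A0_const (A0_gen SideA 1) (A0_gen SideB (g * inverse ga)) \<in> carrier A0_ring"
      by (rule qcomm_closed[OF ring_A0 const cl(2,2)])
  qed (rule cl)
  have s: "A0_lift conj_s (A0_gen SideA g) = A0_gen SideB (fswap g)"
    "A0_lift conj_s (A0_gen SideB g) = A0_gen SideA (fswap g)" for g
    by (rule A0_eqI; simp add: cl A0_eval_lift A0_eval_gen conj_s_gen)+
  have rel: "A0_lift conj_s (A0_lift conj_s x) = x"
    "A0_lift conj_a (A0_lift conj_s (A0_lift conj_a (A0_lift conj_s (A0_lift conj_a (A0_lift conj_s x))))) = x"
    if "x \<in> carrier A0_ring" for x
    by (rule A0_eqI; simp add: that cl A0_eval_lift conj_s_s conj_as_cubed)+
  show ?thesis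
    unfolding modular_action_def
    by (intro conjI allI ballI A0_lift_iso conj_a_iso conj_s_iso a_A a_B s rel)
qed

text \<open>Both ways around the square are homomorphisms from the free algebra once precomposed
  with \<open>A_proj\<close>, so comparing them on scalars and generators suffices.\<close>

lemma A0_induces:
  assumes f: "f \<in> alg_hom A_ring A_const A_ring A_const" and f0: "f0 \<in> alg_hom A0_ring A0_const A0_ring A0_const"
    and gen: "\<And>X g. A0_proj (f (A_gen X g)) = f0 (A0_gen X g)"
  shows "induces A_ring A0_proj f f0"
  unfolding induces_def
proof
  fix z assume "z \<in> carrier A_ring"
  then obtain x where x: "z = A_proj x"
    using A_proj_surj by blast
  have "A0_proj \<circ> (f \<circ> A_proj) \<in> ring_hom F_ring A0_ring"
    by (intro ring_hom_trans[OF _ A0_proj_hom] ring_hom_trans[OF A_proj_hom] alg_homD(1)[OF f])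
  moreover have "f0 \<circ> proj \<in> ring_hom F_ring A0_ring"
    by (intro ring_hom_trans[OF proj_hom] alg_homD(1)[OF f0])
  ultimately have "(A0_proj \<circ> (f \<circ> A_proj)) x = (f0 \<circ> proj) x"
  proof (rule F_hom_eqI)
    show "(A0_proj \<circ> (f \<circ> A_proj)) (F_const c) = (f0 \<circ> proj) (F_const c)" for c
      using alg_homD(2)[OF f, of c] alg_homD(2)[OF f0, of c]
      by (simp add: A_const_def A0_const_def proj_def)
    show "(A0_proj \<circ> (f \<circ> A_proj)) (Og X g) = (f0 \<circ> proj) (Og X g)" for X g
      using gen[of X g] by (simp add: A_gen_def A0_gen_def proj_def)
  qed
  then show "A0_proj (f z) = f0 (A0_proj z)"
    by (simp add: x proj_def)
qed

lemma A_const_closed: "A_const c \<in> carrier A_ring"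
  by (simp add: A_const_def)

lemma A_gen_closed: "A_gen X g \<in> carrier A_ring"
  by (simp add: A_gen_def)

text \<open>Both actions are given by the same formulas in the generators, and the projection, being
  an algebra homomorphism, carries one formula to the other.\<close>

lemma modular_action_induces:
  assumes A: "modular_action A_ring A_const A_gen aA sA"
    and A0: "modular_action A0_ring A0_const A0_gen a0 s0"
  shows "induces A_ring A0_proj aA a0" "induces A_ring A0_proj sA s0"
proof -
  interpret ring A_ring by (rule ring_A)
  have p: "A0_proj \<in> alg_hom A_ring A_const A0_ring A0_const"
    by (rule alg_homI[OF A0_proj_hom]) (simp add: A0_const_def)
  note cl = A_gen_closed A_const_closed
  note aA = A[unfolded modular_action_def] and a0 = A0[unfolded modular_action_def]
  have iso: "aA \<in> alg_iso A_ring A_const A_ring A_const" "sA \<in> alg_iso A_ring A_const A_ring A_const"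
    "a0 \<in> alg_iso A0_ring A0_const A0_ring A0_const" "s0 \<in> alg_iso A0_ring A0_const A0_ring A0_const"
    using aA a0 by blast+
  show "induces A_ring A0_proj sA s0"
  proof (rule A0_induces[OF alg_isoD(1)[OF iso(2)] alg_isoD(1)[OF iso(4)]])
    show "A0_proj (sA (A_gen X g)) = s0 (A0_gen X g)" for X g
      using aA a0 by (cases X) (simp_all add: A0_gen_def)
  qed
  show "induces A_ring A0_proj aA a0"
  proof (rule A0_induces[OF alg_isoD(1)[OF iso(1)] alg_isoD(1)[OF iso(3)]])
    show "A0_proj (aA (A_gen X g)) = a0 (A0_gen X g)" for X g
    proof (cases X)
      case SideA
      have "aA (A_gen SideA g) = A_const (- 1 / dq ^ 2) \<otimes>\<^bsub>A_ring\<^esub>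
          (A_gen SideA 1 \<otimes>\<^bsub>A_ring\<^esub> A_gen SideA (g * inverse ga) \<otimes>\<^bsub>A_ring\<^esub> A_gen SideA 1)"
        using aA by blast
      moreover have "a0 (A0_gen SideA g) = A0_const (- 1 / dq ^ 2) \<otimes>\<^bsub>A0_ring\<^esub>
          (A0_gen SideA 1 \<otimes>\<^bsub>A0_ring\<^esub> A0_gen SideA (g * inverse ga) \<otimes>\<^bsub>A0_ring\<^esub> A0_gen SideA 1)"
        using a0 by blast
      ultimately show ?thesis
        unfolding SideA A0_gen_def A0_const_def
        by (simp only: ring_hom_mult[OF A0_proj_hom] cl m_closed)
    next
      case SideB
      have "aA (A_gen SideB g) = qcomm A_ring A_const (A_gen SideA 1) (A_gen SideB (g * inverse ga))"
        using aA by blast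
      moreover have "a0 (A0_gen SideB g) = qcomm A0_ring A0_const (A0_gen SideA 1) (A0_gen SideB (g * inverse ga))"
        using a0 by blast
      moreover have "range A_const \<subseteq> carrier A_ring"
        using cl by blast
      ultimately show ?thesis
        using alg_hom_qcomm[OF p ring_A ring_A0 _ cl(1,1)] unfolding SideB A0_gen_def by metis
    qed
  qed
qed

section \<open>The level 2 module of the spherical DAHA\<close>

lemma xconst_1: "xconst 1 = 1"
  by (simp add: xconst_def pCons_one flip: One_fract_def)

lemma xconst_mult: "xconst c * xconst d = xconst (c * d)"
  by (simp add: xconst_def mult.commute)

lemma op_const_1: "op_const 1 = id"
  by (simp add: fun_eq_iff op_const_def xconst_1)

section \<open>Substitution and evaluation of rational functions\<close>

lemma pcompose_scale_nz: "r \<noteq> 0 \<Longrightarrow> d \<noteq> 0 \<Longrightarrow> pcompose d [:0, r :: kfield:] \<noteq> 0"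
  using pcompose_eq_0[of d "[:0, r:]"] by auto

text \<open>Resolves the definite description: two representations satisfy
  \<open>p * d' = p' * d\<close>, substitution preserves this identity, and
  \<open>r \<noteq> 0\<close> keeps the denominators nonzero.\<close>

lemma qshift_Fract:
  assumes "r \<noteq> 0" "d \<noteq> 0"
  shows "qshift r (Fraction_Field.Fract p d) =
    Fraction_Field.Fract (pcompose p [:0, r:]) (pcompose d [:0, r:])"
  unfolding qshift_def
proof (rule the_equality)
  fix g assume "\<exists>p' d'. d' \<noteq> 0 \<and> Fraction_Field.Fract p d = Fraction_Field.Fract p' d' \<and>
       g = Fraction_Field.Fract (pcompose p' [:0, r:]) (pcompose d' [:0, r:])"
  then obtain p' d' where d': "d' \<noteq> 0" "Fraction_Field.Fract p d = Fraction_Field.Fract p' d'"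
    and g: "g = Fraction_Field.Fract (pcompose p' [:0, r:]) (pcompose d' [:0, r:])"
    by blast
  have "pcompose (p * d') [:0, r:] = pcompose (p' * d) [:0, r:]"
    using d' assms(2) by (simp add: eq_fract)
  then show "g = Fraction_Field.Fract (pcompose p [:0, r:]) (pcompose d [:0, r:])"
    unfolding g using pcompose_scale_nz[OF assms(1)] d'(1) assms(2) by (simp add: eq_fract pcompose_mult)
qed (use assms in blast)

lemma qshift_add: "r \<noteq> 0 \<Longrightarrow> qshift r (f + g) = qshift r f + qshift r g"
  by (cases f; cases g) (simp add: qshift_Fract pcompose_scale_nz pcompose_add pcompose_mult)

lemma qshift_scale: "r \<noteq> 0 \<Longrightarrow> qshift r (xconst c * f) = xconst c * qshift r f"
  by (cases f) (simp add: xconst_def qshift_Fract pcompose_scale_nz pcompose_smult)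

text \<open>A relation and not a function, because a fraction has a value at \<open>x\<close> only
  if some representative has a denominator that does not vanish there.\<close>

definition evaluates :: "xfield \<Rightarrow> kfield \<Rightarrow> kfield \<Rightarrow> bool" where
  "evaluates f x v \<longleftrightarrow>
     (\<exists>p d. f = Fraction_Field.Fract p d \<and> poly d x \<noteq> 0 \<and> v = poly p x / poly d x)"

lemma evaluates_unique:
  assumes "evaluates f x v" "evaluates f x w" shows "v = w"
proof -
  obtain p d p' d' where f: "f = Fraction_Field.Fract p d" "f = Fraction_Field.Fract p' d'"
    and nz: "poly d x \<noteq> 0" "poly d' x \<noteq> 0" and v: "v = poly p x / poly d x" "w = poly p' x / poly d' x"
    using assms unfolding evaluates_def by blast
  have "d \<noteq> 0" "d' \<noteq> 0"
    using nz by auto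
  then have "p * d' = p' * d"
    using f by (simp add: eq_fract)
  then have "poly p x * poly d' x = poly p' x * poly d x"
    by (metis poly_mult)
  then show ?thesis
    using nz by (simp add: v field_simps)
qed

lemma evaluates_const: "evaluates (xconst c) x c"
  unfolding evaluates_def by (intro exI[of _ "[:c:]"] exI[of _ 1]) (simp add: xconst_def)

lemma evaluates_1: "evaluates 1 x 1"
  using evaluates_const[of 1] by (simp add: xconst_1)

lemma evaluates_xvar: "evaluates xvar x x"
  unfolding evaluates_def by (intro exI[of _ "[:0, 1:]"] exI[of _ 1]) (simp add: xvar_def)

lemma evaluates_add:
  assumes "evaluates f x v" "evaluates g x w" shows "evaluates (f + g) x (v + w)"
proof -
  obtain p d p' d' where f: "f = Fraction_Field.Fract p d" "g = Fraction_Field.Fract p' d'"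
    and nz: "poly d x \<noteq> 0" "poly d' x \<noteq> 0" and v: "v = poly p x / poly d x" "w = poly p' x / poly d' x"
    using assms unfolding evaluates_def by blast
  have "d \<noteq> 0" "d' \<noteq> 0"
    using nz by auto
  then show ?thesis
    unfolding evaluates_def using nz
    by (intro exI[of _ "p * d' + p' * d"] exI[of _ "d * d'"]) (simp add: f v add_frac_eq)
qed

lemma evaluates_mult:
  assumes "evaluates f x v" "evaluates g x w" shows "evaluates (f * g) x (v * w)"
proof -
  obtain p d p' d' where f: "f = Fraction_Field.Fract p d" "g = Fraction_Field.Fract p' d'"
    and nz: "poly d x \<noteq> 0" "poly d' x \<noteq> 0" and v: "v = poly p x / poly d x" "w = poly p' x / poly d' x"
    using assms unfolding evaluates_def by blast
  show ?thesis
    unfolding evaluates_def using nz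
    by (intro exI[of _ "p * p'"] exI[of _ "d * d'"]) (simp add: f v)
qed

lemma evaluates_inverse:
  assumes "evaluates f x v" "v \<noteq> 0" shows "evaluates (1 / f) x (1 / v)"
proof -
  obtain p d where f: "f = Fraction_Field.Fract p d"
    and nz: "poly d x \<noteq> 0" and v: "v = poly p x / poly d x"
    using assms unfolding evaluates_def by blast
  have "poly p x \<noteq> 0"
    using assms v by auto
  then show ?thesis
    unfolding evaluates_def using nz
    by (intro exI[of _ d] exI[of _ p]) (simp add: f v inverse_eq_divide[symmetric])
qed

lemma evaluates_diff:
  assumes "evaluates f x v" "evaluates g x w" shows "evaluates (f - g) x (v - w)"
proof -
  have "xconst (- 1) * g = - g"
    by (cases g) (simp add: xconst_def)
  then have "f + xconst (- 1) * g = f - g"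
    by simp
  then show ?thesis
    using evaluates_add[OF assms(1) evaluates_mult[OF evaluates_const[of "- 1"] assms(2)]] by simp
qed

lemma evaluates_divide:
  assumes "evaluates f x v" "evaluates g x w" "w \<noteq> 0" shows "evaluates (f / g) x (v / w)"
  using evaluates_mult[OF assms(1) evaluates_inverse[OF assms(2,3)]] by simp

lemma evaluates_qshift:
  assumes "r \<noteq> 0" "evaluates f (r * x) v" shows "evaluates (qshift r f) x v"
proof -
  obtain p d where f: "f = Fraction_Field.Fract p d"
    and nz: "poly d (r * x) \<noteq> 0" and v: "v = poly p (r * x) / poly d (r * x)"
    using assms unfolding evaluates_def by blast
  have "d \<noteq> 0"
    using nz by auto
  then show ?thesis
    unfolding evaluates_def using nz assms(1)
    by (intro exI[of _ "pcompose p [:0, r:]"] exI[of _ "pcompose d [:0, r:]"])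
      (simp add: f v qshift_Fract poly_pcompose mult.commute)
qed

text \<open>
  The shifts move the points \<open>pt k\<close> to their neighbours, so a space of functions that are regular at
  all these points is invariant, although only \<open>k = -1, 0, 1\<close> matter in the end.
\<close>

definition pt :: "int \<Rightarrow> kfield" where
  "pt k = cconst \<i> * QQ powi (2 * k)"

lemma pt_nz: "pt k \<noteq> 0"
  by (simp add: pt_def QQ_nz cconst_eq_0)

lemma pt_shift: "QQ ^ 2 * pt k = pt (k + 1)" "1 / QQ ^ 2 * pt k = pt (k - 1)"
  using QQ_nz by (simp_all add: pt_def distrib_left right_diff_distrib power_int_add power_int_diff)

lemma pt_sq: "pt k ^ 2 = - (QQ powi (4 * k))"
proof -
  have "pt k ^ 2 = (cconst \<i> * cconst \<i>) * (QQ powi (2 * k) * QQ powi (2 * k))"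
    by (simp add: pt_def power2_eq_square)
  also have "QQ powi (2 * k) * QQ powi (2 * k) = QQ powi (4 * k)"
    using QQ_nz by (simp flip: power_int_add)
  finally show ?thesis
    by (simp add: cconst_ii_sq)
qed

text \<open>The coefficients of the difference operator have no pole at the points
  \<open>pt k\<close>: the square is minus a power of \<open>QQ\<close>, which is \<open>-1\<close>
  for \<open>k = 0\<close> and not constant otherwise.\<close>

lemma pt_sq_ne_1: "pt k ^ 2 \<noteq> 1"
proof
  assume "pt k ^ 2 = 1"
  then have m1: "QQ powi (4 * k) = - 1"
    by (simp add: pt_sq minus_equation_iff)
  \<comment> \<open>The absolute value turns the integer power into a natural one; for negative
    \<open>k\<close> this works because \<open>-1\<close> is its own inverse.\<close>
  have "QQ ^ nat (4 * \<bar>k\<bar>) = - 1"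
  proof (cases "k \<ge> 0")
    case True
    then show ?thesis
      using m1 by (simp add: power_int_def)
  next
    case False
    then have "inverse (QQ ^ nat (4 * \<bar>k\<bar>)) = - 1"
      using m1 by (simp add: power_int_def power_inverse)
    then show ?thesis
      by (metis inverse_inverse_eq inverse_minus_eq inverse_1)
  qed
  then have *: "QQ ^ nat (4 * \<bar>k\<bar>) = cconst (- 1)"
    by (simp add: cconst_uminus cconst_one)
  show False
  proof (cases "k = 0")
    case True
    then have "cconst (1 + 1) = 0"
      using * by (simp only: cconst_add cconst_one) (simp add: cconst_uminus cconst_one)
    then show False
      by (simp add: cconst_eq_0)
  next
    case False
    then show False
      using QQ_power_ne[of "nat (4 * \<bar>k\<bar>)" "- 1"] * by simp
  qed
qed

section \<open>Action of the generators on values at the points\<close>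

definition regular :: "xfield \<Rightarrow> bool" where
  "regular f \<longleftrightarrow> (\<forall>k. \<exists>v. evaluates f (pt k) v)"

definition pval :: "xfield \<Rightarrow> int \<Rightarrow> kfield" where
  "pval f k = (THE v. evaluates f (pt k) v)"

lemma pval_eqI: "evaluates f (pt k) v \<Longrightarrow> pval f k = v"
  unfolding pval_def using evaluates_unique by blast

lemma pval: "regular f \<Longrightarrow> evaluates f (pt k) (pval f k)"
  using pval_eqI by (auto simp: regular_def)

lemma regular_pvalI:
  assumes "\<And>k. evaluates f (pt k) (v k)"
  shows "regular f" "pval f k = v k"
  using assms pval_eqI by (auto simp: regular_def)

lemma evaluates_daha_D:
  assumes "regular f"
  shows "evaluates (daha_D (QQ ^ 2) t f) (pt k)
    ((1 - t * pt k ^ 2) / (1 - pt k ^ 2) * pval f (k + 1)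
     + (1 - t * (1 / pt k ^ 2)) / (1 - 1 / pt k ^ 2) * pval f (k - 1))"
proof -
  have sq: "evaluates (xvar ^ 2) (pt k) (pt k ^ 2)"
    unfolding power2_eq_square by (intro evaluates_mult evaluates_xvar)
  have nz: "1 - pt k ^ 2 \<noteq> 0" "1 - 1 / pt k ^ 2 \<noteq> 0" "pt k ^ 2 \<noteq> 0"
    using pt_sq_ne_1[of k] pt_nz[of k] by (auto simp: field_simps)
  have "evaluates (qshift (QQ ^ 2) f) (pt k) (pval f (k + 1))"
    "evaluates (qshift (1 / QQ ^ 2) f) (pt k) (pval f (k - 1))"
    using QQ_nz pval[OF assms] by (auto intro!: evaluates_qshift simp only: pt_shift) simp_all
  then show ?thesis
    unfolding daha_D_def using nz
    by (intro evaluates_add evaluates_mult evaluates_divide evaluates_diff evaluates_1 evaluates_const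
        evaluates_inverse sq)
qed

lemma pval_daha_Y:
  assumes "regular f"
  shows "regular (daha_Y f)" "pval (daha_Y f) k = (pt k + 1 / pt k) * pval f k"
proof -
  have "evaluates (daha_Y f) (pt k) ((pt k + 1 / pt k) * pval f k)" for k
    unfolding daha_Y_def
    by (intro evaluates_mult evaluates_add evaluates_inverse evaluates_xvar pval assms pt_nz)
  from regular_pvalI[OF this] show "regular (daha_Y f)" "pval (daha_Y f) k = (pt k + 1 / pt k) * pval f k" .
qed

lemma pval_op_const:
  assumes "regular f"
  shows "regular (op_const c f)" "pval (op_const c f) k = c * pval f k"
proof -
  have "evaluates (op_const c f) (pt k) (c * pval f k)" for k
    unfolding op_const_def by (intro evaluates_mult evaluates_const pval assms)
  from regular_pvalI[OF this] show "regular (op_const c f)" "pval (op_const c f) k = c * pval f k" .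
qed

lemma pval_add:
  assumes "regular f" "regular g"
  shows "regular (f + g)" "pval (f + g) k = pval f k + pval g k"
proof -
  have "evaluates (f + g) (pt k) (pval f k + pval g k)" for k
    by (intro evaluates_add pval assms)
  from regular_pvalI[OF this] show "regular (f + g)" "pval (f + g) k = pval f k + pval g k" .
qed

lemma pt_values: "pt 0 = cconst \<i>" "pt 1 = cconst \<i> * QQ ^ 2" "pt (- 1) = cconst \<i> / QQ ^ 2"
  using QQ_nz by (simp_all add: pt_def power_int_def power_inverse divide_inverse)

lemma regular_daha_D: "regular f \<Longrightarrow> regular (daha_D (QQ ^ 2) t f)"
  using evaluates_daha_D unfolding regular_def by blast

lemma QQ4_nz: "1 + QQ ^ 4 \<noteq> 0"
proof
  assume "1 + QQ ^ 4 = 0"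
  then have "QQ ^ 4 = - 1"
    by (simp add: eq_neg_iff_add_eq_0 add.commute)
  then show False
    using pt_sq_ne_1[of 1] by (simp add: pt_sq)
qed

lemma divide_cconst_ii: "1 / cconst \<i> = - cconst \<i>" "1 / (cconst \<i> * x) = - cconst \<i> / x"
  "1 / (cconst \<i> / x) = - cconst \<i> * x"
proof -
  have "cconst \<i> \<noteq> 0"
    by (simp add: cconst_eq_0)
  then show *: "1 / cconst \<i> = - cconst \<i>"
    using cconst_ii_sq by (simp add: field_simps)
  show "1 / (cconst \<i> * x) = - cconst \<i> / x"
    using * by (simp flip: divide_divide_eq_left)
  show "1 / (cconst \<i> / x) = - cconst \<i> * x"
    by (simp flip: *)
qed

text \<open>At \<open>pt 0\<close>, whose square is \<open>-1\<close>, both coefficients are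
  \<open>(1 + t) / 2\<close>. At \<open>pt 1\<close> and \<open>pt (- 1)\<close> the coefficient of
  the shift leading outwards vanishes, so the three values form a closed system.\<close>

lemma pval_daha_D:
  assumes "regular f"
  shows "pval (daha_D (QQ ^ 2) (level_t 2) f) 0 = (1 - 1 / QQ ^ 4) / 2 * (pval f 1 + pval f (- 1))"
    "pval (daha_D (QQ ^ 2) (level_t 2) f) 1 = (1 - 1 / QQ ^ 4) * pval f 0"
    "pval (daha_D (QQ ^ 2) (level_t 2) f) (- 1) = (1 - 1 / QQ ^ 4) * pval f 0"
proof -
  have t: "level_t 2 = - 1 / QQ ^ 4"
    by (simp add: level_t_def flip: power_mult)
  have i2: "(cconst \<i>)\<^sup>2 = - 1"
    using cconst_ii_sq by (simp add: power2_eq_square)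
  note ev = evaluates_daha_D[OF assms, THEN pval_eqI, of "level_t 2"]
  show "pval (daha_D (QQ ^ 2) (level_t 2) f) 0 = (1 - 1 / QQ ^ 4) / 2 * (pval f 1 + pval f (- 1))"
    using ev[of 0] by (simp add: pt_values i2 t distrib_left)
  have sq: "pt 1 ^ 2 = - (QQ ^ 4)" "pt (- 1) ^ 2 = - (1 / QQ ^ 4)"
    by (simp_all add: pt_values power_mult_distrib power_divide i2 flip: power_mult)
  \<comment> \<open>The numerator of the outward coefficient; this is where the level
    enters.\<close>
  have c: "(1 - level_t 2 * - (QQ ^ 4)) = 0"
    using QQ_nz by (simp add: t)
  have c': "(1 - level_t 2 * - (1 / QQ ^ 4)) / (1 - - (1 / QQ ^ 4)) = 1 - 1 / QQ ^ 4"
    using QQ4_nz QQ_nz by (simp add: t divide_simps) (simp add: algebra_simps)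
  have r: "1 / - (QQ ^ 4) = - (1 / QQ ^ 4)" "1 / - (1 / QQ ^ 4) = - (QQ ^ 4)"
    by simp_all
  show "pval (daha_D (QQ ^ 2) (level_t 2) f) 1 = (1 - 1 / QQ ^ 4) * pval f 0"
    using ev[of 1] unfolding sq r c c' by simp
  show "pval (daha_D (QQ ^ 2) (level_t 2) f) (- 1) = (1 - 1 / QQ ^ 4) * pval f 0"
    using ev[of "- 1"] unfolding sq r c c' by simp
qed

text \<open>
  The coordinates are the left eigenvectors of the first generator on triples of values, with eigenvalues
  \<open>- \<i> dq, 0, \<i> dq\<close>, scaled such that the second generator acts by \<^const>\<open>matY\<close>.
\<close>

definition ev3 :: "xfield \<Rightarrow> kfield ^ 3" where
  "ev3 f = vector [pval f (- 1) + 2 * pval f 0 + pval f 1,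
     cconst \<i> * dq * (pval f 1 - pval f (- 1)),
     dq ^ 2 / 2 * (2 * pval f 0 - pval f 1 - pval f (- 1))]"

text \<open>\<open>T\<close> descends along \<open>ev3\<close>: represented operators preserve the
  regular functions with zero coordinates, and the module is the quotient of the regular functions
  by these.\<close>

definition acts :: "(xfield \<Rightarrow> xfield) \<Rightarrow> kfield ^ 3 ^ 3 \<Rightarrow> bool" where
  "acts T M \<longleftrightarrow> (\<forall>f. regular f \<longrightarrow> regular (T f) \<and> ev3 (T f) = M *v ev3 f)"

lemma acts_const: "acts (op_const c) (mat c)"
  unfolding acts_def
  by (auto simp: pval_op_const ev3_def vec_eq_iff forall_3 matrix_vector_mult_def sum_3 mat_def algebra_simps)

lemma acts_add: "acts S M \<Longrightarrow> acts T N \<Longrightarrow> acts (\<lambda>f. S f + T f) (M + N)"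
proof -
  have "ev3 (f + g) = ev3 f + ev3 g" if "regular f" "regular g" for f g
    using that by (simp add: ev3_def pval_add vec_eq_iff forall_3 ring_distribs add_divide_distrib diff_divide_distrib)
  then show "acts S M \<Longrightarrow> acts T N \<Longrightarrow> acts (\<lambda>f. S f + T f) (M + N)"
    by (simp add: acts_def pval_add matrix_vector_mult_add_rdistrib)
qed

lemma acts_comp: "acts S M \<Longrightarrow> acts T N \<Longrightarrow> acts (S \<circ> T) (M ** N)"
  by (simp add: acts_def matrix_vector_mul_assoc)

lemma acts_daha_Y: "acts daha_Y matY"
proof -
  \<comment> \<open>In point values this generator is diagonal, with the same eigenvalues as
    \<open>matX\<close>.\<close>
  have "pt 0 + 1 / pt 0 = 0" "pt 1 + 1 / pt 1 = cconst \<i> * dq" "pt (- 1) + 1 / pt (- 1) = - (cconst \<i> * dq)"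
    unfolding pt_values dq_def divide_cconst_ii by (simp_all add: algebra_simps)
  then show ?thesis
    by (auto simp: acts_def pval_daha_Y ev3_def vec_eq_iff forall_3 matrix_vector_mult_def sum_3 matY_def
        algebra_simps cconst_ii_sq cconst_ii_mult_left numeral_kfield_nz power2_eq_square)
qed

lemma acts_S2_X: "acts S2_X matX"
proof -
  \<comment> \<open>The rescaling turns the common factor of the point values into minus i
    dq.\<close>
  have d: "QQ ^ 2 * (1 - 1 / QQ ^ 4) = dq"
    using QQ_nz by (simp add: dq_def right_diff_distrib power4_eq_xxxx power2_eq_square)
  have reg: "regular (S2_X f)" and S2_X: "pval (S2_X f) k =
      - (cconst \<i> * QQ ^ 2) * pval (daha_D (QQ ^ 2) (level_t 2) f) k" if "regular f" for f k
    using that by (simp_all add: S2_X_def pval_op_const regular_daha_D)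
  have "ev3 (S2_X f) = matX *v ev3 f" if "regular f" for f
  proof -
    have "pval (S2_X f) 0 = - (cconst \<i> * dq) / 2 * (pval f 1 + pval f (- 1))"
      "pval (S2_X f) 1 = - (cconst \<i> * dq) * pval f 0"
      "pval (S2_X f) (- 1) = - (cconst \<i> * dq) * pval f 0"
      using that by (simp_all add: S2_X pval_daha_D flip: d)
    note X = this
    show ?thesis
      unfolding ev3_def X by (simp add: vec_eq_iff forall_3 matrix_vector_mult_def sum_3 matX_def
        field_simps numeral_kfield_nz cconst_ii_sq cconst_ii_mult_left power2_eq_square)
  qed
  then show ?thesis
    using reg by (simp add: acts_def)
qed

text \<open>The constant function 1 and its first two images under \<open>daha_Y\<close> have
  coordinate vectors that form a basis, so the matrix is determined.\<close>

lemma acts_unique: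
  assumes "acts T M" "acts T N" shows "M = N"
proof -
  define f0 f1 f2 where "f0 = (1 :: xfield)" and "f1 = daha_Y f0" and "f2 = daha_Y f1"
  have "evaluates 1 (pt k) 1" for k
    by (rule evaluates_1)
  from regular_pvalI[OF this] have f0: "regular f0" "ev3 f0 = vector [4, 0, 0]"
    by (auto simp: f0_def ev3_def)
  have "regular (daha_Y f) \<and> ev3 (daha_Y f) = matY *v ev3 f" if "regular f" for f
    using acts_daha_Y that by (simp add: acts_def)
  note Y = this[THEN conjunct1] this[THEN conjunct2]
  have f1: "regular f1" "ev3 f1 = vector [0, - (2 * dq ^ 2), 0]"
    and f2: "regular f2" "ev3 f2 = vector [- (2 * dq ^ 2), 0, dq ^ 4]"
    unfolding f2_def f1_def
    by (simp_all add: Y f0 vec_eq_iff forall_3 matrix_vector_mult_def sum_3 matY_def numeral_kfield_nz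
        power2_eq_square power4_eq_xxxx field_simps)
  have eq: "M *v ev3 f = N *v ev3 f" if "regular f" for f
    using assms that by (metis acts_def)
  show ?thesis
    using eq[OF f0(1)] eq[OF f1(1)] eq[OF f2(1)] unfolding f0 f1 f2
    by (simp add: vec_eq_iff forall_3 matrix_vector_mult_def sum_3 dq_nz numeral_kfield_nz)
qed

section \<open>The spherical DAHA as an algebra of operators\<close>

lemma End_simps [simp]:
  "carrier End_ring = {T. (\<forall>f g. T (f + g) = T f + T g) \<and> (\<forall>c f. T (xconst c * f) = xconst c * T f)}"
  "S \<otimes>\<^bsub>End_ring\<^esub> T = S \<circ> T" "\<one>\<^bsub>End_ring\<^esub> = id"
  "\<zero>\<^bsub>End_ring\<^esub> = (\<lambda>f. 0)" "S \<oplus>\<^bsub>End_ring\<^esub> T = (\<lambda>f. S f + T f)"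
  by (simp_all add: End_ring_def)

lemma ring_End: "ring End_ring"
proof (rule ringI)
  show "abelian_group End_ring"
  proof (rule abelian_groupI)
    fix T assume "T \<in> carrier End_ring"
    then show "\<exists>S \<in> carrier End_ring. S \<oplus>\<^bsub>End_ring\<^esub> T = \<zero>\<^bsub>End_ring\<^esub>"
      by (intro bexI[of _ "\<lambda>f. - T f"]) auto
  qed (auto simp: algebra_simps)
  show "Group.monoid End_ring"
    by (rule monoidI) auto
qed auto

lemma mult_closed: "(\<lambda>f. g * f) \<in> carrier End_ring"
  by (simp add: distrib_left mult.left_commute)

lemma op_const_closed: "op_const c \<in> carrier End_ring"
  using mult_closed by (simp add: op_const_def[abs_def])

lemma daha_Y_closed: "daha_Y \<in> carrier End_ring"
  using mult_closed unfolding daha_Y_def[abs_def] .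

lemma daha_D_closed:
  assumes "r \<noteq> 0" shows "daha_D r t \<in> carrier End_ring"
proof -
  have "(\<lambda>f. u * qshift r f + v * qshift (1 / r) f) \<in> carrier End_ring" for u v
    using assms by (simp add: qshift_add qshift_scale distrib_left mult.left_commute add_ac)
  then show ?thesis
    unfolding daha_D_def[abs_def] .
qed

lemma S2_gens: "range op_const \<union> {daha_D (QQ ^ 2) (level_t 2), daha_Y} \<subseteq> carrier End_ring"
  using op_const_closed daha_D_closed[of "QQ ^ 2"] daha_Y_closed QQ_nz by (auto simp del: End_simps)

lemma S2_carrier: "carrier S2_ring =
    generate_ring End_ring (range op_const \<union> {daha_D (QQ ^ 2) (level_t 2), daha_Y})"
  by (simp add: SDAHA_def subalg_gen_def)

lemma S2_ops:
  "S \<otimes>\<^bsub>S2_ring\<^esub> T = S \<circ> T" "S \<oplus>\<^bsub>S2_ring\<^esub> T = (\<lambda>f. S f + T f)" "\<one>\<^bsub>S2_ring\<^esub> = id"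
  by (simp_all add: SDAHA_def subalg_gen_def End_ring_def)

lemma ring_S2: "ring S2_ring"
  unfolding SDAHA_def subalg_gen_def by (rule ring.generate_ring_is_ring[OF ring_End S2_gens])

lemma S2_closed: "op_const c \<in> carrier S2_ring" "daha_Y \<in> carrier S2_ring"
  "daha_D (QQ ^ 2) (level_t 2) \<in> carrier S2_ring" "S2_X \<in> carrier S2_ring"
proof -
  show *: "op_const c \<in> carrier S2_ring" "daha_Y \<in> carrier S2_ring"
    "daha_D (QQ ^ 2) (level_t 2) \<in> carrier S2_ring" for c
    unfolding S2_carrier by (auto intro: generate_ring.incl)
  have "op_const (- (cconst \<i> * QQ ^ 2)) \<otimes>\<^bsub>S2_ring\<^esub> daha_D (QQ ^ 2) (level_t 2) \<in> carrier S2_ring"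
    by (rule ring.ring_simprules(5)[OF ring_S2 *(1,3)])
  then show "S2_X \<in> carrier S2_ring"
    by (simp add: S2_ops S2_X_def)
qed

lemma daha_D_eq: "op_const (1 / - (cconst \<i> * QQ ^ 2)) \<circ> S2_X = daha_D (QQ ^ 2) (level_t 2)"
proof -
  let ?c = "- (cconst \<i> * QQ ^ 2)"
  have "?c \<noteq> 0"
    using QQ_nz by (simp add: cconst_eq_0)
  then have "xconst (1 / ?c) * xconst ?c = 1"
    by (simp add: xconst_mult xconst_1)
  then show ?thesis
    by (simp add: fun_eq_iff S2_X_def op_const_def flip: mult.assoc)
qed

text \<open>The rescaled \<open>S2_X\<close> replaces the difference operator, which is recovered by
  a scalar. Units and negatives are covered by the scalars 1 and \<open>-1\<close>.\<close>

lemma S2_induct [consumes 1, case_names const X Y add mult]: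
  assumes "T \<in> carrier S2_ring"
    and const: "\<And>c. P (op_const c)" and X: "P S2_X" and Y: "P daha_Y"
    and add: "\<And>S T. S \<in> carrier S2_ring \<Longrightarrow> T \<in> carrier S2_ring \<Longrightarrow> P S \<Longrightarrow> P T \<Longrightarrow> P (\<lambda>f. S f + T f)"
    and mult: "\<And>S T. S \<in> carrier S2_ring \<Longrightarrow> T \<in> carrier S2_ring \<Longrightarrow> P S \<Longrightarrow> P T \<Longrightarrow> P (S \<circ> T)"
  shows "P T"
  using assms(1) unfolding S2_carrier
proof (induction T rule: generate_ring.induct)
  case one
  show ?case
    using const[of 1] unfolding End_simps op_const_1 .
next
  case (incl h)
  have "P (daha_D (QQ ^ 2) (level_t 2))"
    using mult[OF S2_closed(1,4) const X] by (metis daha_D_eq)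
  then show ?case
    using incl const Y by auto
next
  case (a_inv h)
  interpret ring End_ring by (rule ring_End)
  have h: "h \<in> carrier End_ring"
    using generate_ring_in_carrier[OF S2_gens a_inv.hyps] .
  have m1: "xconst (- 1) * f = - f" for f
    by (cases f) (simp add: xconst_def)
  have "\<ominus>\<^bsub>End_ring\<^esub> h = op_const (- 1) \<circ> h"
    using h op_const_closed[of "- 1"] by (intro minus_equality) (auto simp: op_const_def m1 fun_eq_iff)
  then show ?case
    using mult[OF S2_closed(1) _ const a_inv.IH] a_inv.hyps unfolding S2_carrier by metis
next
  case (eng_add S T)
  then show ?case
    using add by (simp add: S2_carrier)
next
  case (eng_mult S T)
  then show ?case
    using mult unfolding S2_carrier End_simps by metis
qed

lemma ex_acts: "T \<in> carrier S2_ring \<Longrightarrow> \<exists>M. acts T M"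
proof (induction T rule: S2_induct)
  case (const c)
  show ?case using acts_const by blast
next
  case X
  show ?case using acts_S2_X by blast
next
  case Y
  show ?case using acts_daha_Y by blast
next
  case (add S T)
  then show ?case using acts_add by blast
next
  case (mult S T)
  then show ?case using acts_comp by blast
qed

section \<open>The representation at level 2 and its image\<close>

definition rho2 :: "(xfield \<Rightarrow> xfield) \<Rightarrow> kfield ^ 3 ^ 3" where
  "rho2 T = (THE M. acts T M)"

lemma rho2_eqI: "acts T M \<Longrightarrow> rho2 T = M"
  unfolding rho2_def using acts_unique by blast

lemma acts_rho2: "T \<in> carrier S2_ring \<Longrightarrow> acts T (rho2 T)"
  using ex_acts rho2_eqI by metis

text \<open>Sums and composites of represented operators are represented by sums and products of
  matrices; uniqueness of the matrix turns this into equations.\<close>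

lemma rho2_hom: "rho2 \<in> alg_hom S2_ring op_const Mat3_ring mat"
proof (intro alg_homI ring_hom_memI)
  show "rho2 \<one>\<^bsub>S2_ring\<^esub> = \<one>\<^bsub>Mat3_ring\<^esub>"
    using rho2_eqI[OF acts_const[of 1]] by (simp add: S2_ops op_const_1)
qed (simp_all add: S2_ops rho2_eqI acts_const acts_add acts_comp acts_rho2)

lemma rho2_module: "level2_module rho2"
  by (simp add: level2_module_def rho2_hom rho2_eqI acts_S2_X acts_daha_Y)

lemma S2_hom_eqI:
  assumes "h \<in> ring_hom S2_ring R" "h' \<in> ring_hom S2_ring R"
    and "\<And>c. h (op_const c) = h' (op_const c)" "h S2_X = h' S2_X" "h daha_Y = h' daha_Y"
    and "T \<in> carrier S2_ring"
  shows "h T = h' T"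
  using assms(6)
proof (induction T rule: S2_induct)
  case (add S T)
  show ?case
    using ring_hom_add[OF assms(1) add(1,2)] ring_hom_add[OF assms(2) add(1,2)]
    unfolding S2_ops add by (simp only:)
next
  case (mult S T)
  show ?case
    using ring_hom_mult[OF assms(1) mult(1,2)] ring_hom_mult[OF assms(2) mult(1,2)]
    unfolding S2_ops mult by (simp only:)
qed (fact assms)+

text \<open>The image is closed under sums and products and contains the scalars,
  \<open>matX\<close> and \<open>matY\<close>, hence every matrix.\<close>

lemma rho2_surj: "rho2 ` carrier S2_ring = UNIV"
proof -
  interpret ring S2_ring by (rule ring_S2)
  note hom = alg_homD(1)[OF rho2_hom]
  have "M \<in> rho2 ` carrier S2_ring" for M
  proof (induction M rule: matX_matY_induct)
    case (1 c)
    show ?case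
      by (rule image_eqI[OF _ S2_closed(1)]) (rule alg_homD(2)[OF rho2_hom, symmetric])
  next
    case 2
    show ?case
      by (rule image_eqI[OF _ S2_closed(4)]) (rule rho2_eqI[OF acts_S2_X, symmetric])
  next
    case 3
    show ?case
      by (rule image_eqI[OF _ S2_closed(2)]) (rule rho2_eqI[OF acts_daha_Y, symmetric])
  next
    case (4 M N)
    then obtain S T where ST: "S \<in> carrier S2_ring" "T \<in> carrier S2_ring" "M = rho2 S" "N = rho2 T"
      by blast
    show ?case
      using ring_hom_add[OF hom ST(1,2)] a_closed[OF ST(1,2)] unfolding Mat3_simps ST(3,4) by (metis imageI)
  next
    case (5 M N)
    then obtain S T where ST: "S \<in> carrier S2_ring" "T \<in> carrier S2_ring" "M = rho2 S" "N = rho2 T"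
      by blast
    show ?case
      using ring_hom_mult[OF hom ST(1,2)] m_closed[OF ST(1,2)] unfolding Mat3_simps ST(3,4) by (metis imageI)
  qed
  then show ?thesis by blast
qed

lemma level2_algebra_rho2: "level2_algebra rho2 = Mat3_ring"
  unfolding level2_algebra_def rho2_surj by (simp add: Mat3_ring_def)

text \<open>\<open>rho2\<close> preserves q-commutators, so the actions correspond on the
  generators, and the two composites agree everywhere.\<close>

lemma cherednik_action_induces:
  assumes S: "cherednik_action S2_ring op_const S2_X daha_Y aS bS"
    and M: "cherednik_action Mat3_ring mat matX matY a b"
  shows "induces S2_ring rho2 aS a" "induces S2_ring rho2 bS b"
proof -
  note S = S[unfolded cherednik_action_def] and M = M[unfolded cherednik_action_def]
  have rho: "rho2 S2_X = matX" "rho2 daha_Y = matY"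
    by (rule rho2_eqI[OF acts_S2_X], rule rho2_eqI[OF acts_daha_Y])
  have qc: "rho2 (qcomm S2_ring op_const x y) = qcomm Mat3_ring mat (rho2 x) (rho2 y)"
    if "x \<in> carrier S2_ring" "y \<in> carrier S2_ring" for x y
    by (rule alg_hom_qcomm[OF rho2_hom ring_S2 ring_Mat3 _ that]) (use S2_closed(1) in blast)
  have ind: "induces S2_ring rho2 h g"
    if h: "h \<in> alg_iso S2_ring op_const S2_ring op_const" and g: "g \<in> alg_iso Mat3_ring mat Mat3_ring mat"
      and X: "rho2 (h S2_X) = g matX" and Y: "rho2 (h daha_Y) = g matY" for h g
    unfolding induces_def
  proof
    fix T assume T: "T \<in> carrier S2_ring"
    have "h \<in> ring_hom S2_ring S2_ring" "g \<in> ring_hom Mat3_ring Mat3_ring"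
      using h g by (simp_all add: alg_iso_def alg_hom_def)
    then have "rho2 \<circ> h \<in> ring_hom S2_ring Mat3_ring" "g \<circ> rho2 \<in> ring_hom S2_ring Mat3_ring"
      by (blast intro: ring_hom_trans alg_homD(1)[OF rho2_hom])+
    then have "(rho2 \<circ> h) T = (g \<circ> rho2) T"
    proof (rule S2_hom_eqI[OF _ _ _ _ _ T])
      have "h (op_const c) = op_const c" "g (mat c) = mat c" for c
        using h g by (simp_all add: alg_iso_def alg_hom_def)
      then show "(rho2 \<circ> h) (op_const c) = (g \<circ> rho2) (op_const c)" for c
        by (simp add: alg_homD(2)[OF rho2_hom])
    qed (simp_all add: X Y rho)
    then show "rho2 (h T) = g (rho2 T)"
      by simp
  qed
  show "induces S2_ring rho2 aS a"
    by (rule ind) (use S M qc[OF S2_closed(4,2)] rho in auto)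
  show "induces S2_ring rho2 bS b"
    by (rule ind) (use S M qc[OF S2_closed(2,4)] rho in auto)
qed

theorem proposition35:
  shows "\<exists>rho a0 s0 a b phi.
     level2_module rho \<and>
     modular_action A0_ring A0_const A0_gen a0 s0 \<and>
     (\<forall>aA sA. modular_action A_ring A_const A_gen aA sA \<longrightarrow>
        induces A_ring A0_proj aA a0 \<and> induces A_ring A0_proj sA s0) \<and>
     cherednik_action (level2_algebra rho) mat matX matY a b \<and>
     (\<forall>aS bS. cherednik_action S2_ring op_const S2_X daha_Y aS bS \<longrightarrow>
        induces S2_ring rho aS a \<and> induces S2_ring rho bS b) \<and>
     phi \<in> alg_iso A0_ring A0_const (level2_algebra rho) mat \<and>
     (\<forall>x \<in> carrier A0_ring. phi (a0 x) = a (phi x) \<and> phi (s0 x) = a (b (a (phi x))))"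
proof -
  have A0: "modular_action A0_ring A0_const A0_gen (A0_lift conj_a) (A0_lift conj_s)"
    by (rule modular_action_A0)
  have M: "cherednik_action Mat3_ring mat matX matY conj_a (conj_s \<circ> conj_a \<circ> conj_s)"
    by (rule cherednik_action_Mat3)
  \<comment> \<open>With b = sas this is aba = asasa = s, a consequence of the relations of the
    modular group.\<close>
  have "A0_eval (A0_lift conj_s x) = conj_a ((conj_s \<circ> conj_a \<circ> conj_s) (conj_a (A0_eval x)))" for x
    using conj_as_cubed[of "conj_s (A0_eval x)"] by (simp add: A0_eval_lift conj_s_s)
  then show ?thesis
    using rho2_module A0 M A0_eval_iso
    by (intro exI[of _ rho2] exI[of _ "A0_lift conj_a"] exI[of _ "A0_lift conj_s"] exI[of _ conj_a]
        exI[of _ "conj_s \<circ> conj_a \<circ> conj_s"] exI[of _ A0_eval])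
      (auto simp: level2_algebra_rho2 A0_eval_lift intro: modular_action_induces[OF _ A0] cherednik_action_induces[OF _ M])
qed

end
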